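(* Let $\mu$ be a probability measure on $\mathbb{R}^d$ with compact support $\mathbf{\Omega}$ and density $f$ with respect to the Lebesgue measure, and suppose that for every $\emptyset\neq A\subseteq[d]$: (i) $\mathbf{\Omega}_A=\mathrm{cl}(\mathrm{int}(\mathbf{\Omega}_A))$; (ii) the marginal density $f_A$ is continuous and positive on $\mathrm{int}(\mathbf{\Omega}_A)$; (iii) $f_A=0$ outside of $\mathbf{\Omega}_A$. Assume in addition that $f_A$ is locally Lipschitz on $\mathrm{int}(\mathbf{\Omega}_A)$ for all $\emptyset\neq A\subseteq[d]$. Let $G$ be a graphical model for $\mu$ with junction tree $J$. Then for any $\mathbf{z}\in\mathrm{int}(\mathbf{\Omega})$, $$\lim_{n\to\infty}\epsilon^{-d}\cdot\widetilde\Gamma_n^{\mu,G,J}(\mathbf{z};\epsilon)^{-1}=f(\mathbf{z})+O(\epsilon),\quad\text{as }\epsilon\to0,$$ where $\widetilde\Gamma_n^{\mu,G,J}$ is the regularized rational Christoffel function of $\mu$ associated with $G$ and $J$.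
   Context: Notation. $[d]=\{1,\dots,d\}$. For $A\subseteq[d]$, $\mathbb{R}^d_A$ is the span of the standard basis vectors $e_k$, $k\in A$; $\mathbf{x}_A=(x_k)_{k\in A}\in\mathbb{R}^d_A$ is the projection of $\mathbf{x}\in\mathbb{R}^d$; $\mathbf{\Omega}_A=\{\mathbf{x}_A:\mathbf{x}\in\mathbf{\Omega}\}$. Closure $\mathrm{cl}$ and interior $\mathrm{int}$ of $\mathbf{\Omega}_A$ are taken in $\mathbb{R}^d_A$. $\mu_A$ is the marginal of $\mu$ on $\mathbb{R}^d_A$, with density $f_A(\mathbf{x}_A)=\int f(\mathbf{x}_A,\mathbf{x}_{[d]\setminus A})\,d\mathbf{x}_{[d]\setminus A}$ (and $f_\emptyset=1$). $B_\infty(\mathbf{z},\epsilon)=\{\mathbf{x}:\|\mathbf{x}-\mathbf{z}\|_\infty\le\frac12\epsilon\}$ is the closed $L_\infty$-ball of diameter $\epsilon$ around $\mathbf{z}$, in $\mathbb{R}^d$ or, for points of $\mathbb{R}^d_D$, in $\mathbb{R}^d_D$. The parameter $\epsilon$ is positive, and the constant in $O(\epsilon)$ may depend on $\mathbf{z}$, $\mu$, $G$, $J$ but not on $\epsilon$. Graphical models. For $A,B,C\subseteq[d]$, $A\perp_\mu B\,|\,C$ (conditional independence) means $f_C(\mathbf{x}_C)\,f_{A\cup B\cup C}(\mathbf{x}_{A\cup B\cup C})=f_{A\cup C}(\mathbf{x}_{A\cup C})\,f_{B\cup C}(\mathbf{x}_{B\cup C})$, as an identity of densities (for almost every $\mathbf{x}$).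 In a simple graph $G$ on vertex set $[d]$, $A,B$ are separated by $C$ if every path (including one-vertex paths) between a vertex of $A$ and a vertex of $B$ contains a vertex of $C$. $G$ is a graphical model for $\mu$ if for all $A,B,C\subseteq[d]$: $A,B$ separated by $C$ in $G$ implies $A\perp_\mu B\,|\,C$. Junction trees. A graph is chordal if every cycle of length greater than 3 has a chord. A chordal completion of $G$ is a chordal graph $\overline G$ on the same vertex set with $E(G)\subseteq E(\overline G)$. A junction tree $J$ for $G$ is a tree whose vertex set $V(J)$ is the set of maximal cliques of some chordal completion of $G$, with the clique-intersection property: for every $C\in V(J)$ on the path between $A,B\in V(J)$ in $J$, $A\cap B\subseteq C$. $E(J)$ denotes its edge set. Regularized Christoffel polynomials. For $D\subseteq[d]$ and $n\in\mathbb{N}$, $\mathbb{R}[\mathbf{x}_D]_{\otimes n}$ is the space of real polynomials in the variables $x_k$, $k\in D$, of degree at most $n$ in each variable. For $\mathbf{z}\in\mathbb{R}^d_D$ and $\epsilon>0$, $$\widetilde\Lambda_{\otimes n}^{\mu_D}(\mathbf{z};\epsilon)^{-1}:=\min_{p\in\mathbb{R}[\mathbf{x}_D]_{\otimes n}}\Big\{\int p^2\,d\mu_D:\ \int_{B_\infty(\mathbf{z},\epsilon)}p(\mathbf{y})\,\frac{d\mathbf{y}}{\epsilon^{|D|}}=1\Big\},$$ and $\widetilde\Lambda_{\otimes n}^{\mu_\emptyset}=1$. The regularized rational Christoffel function is $$\widetilde\Gamma_n^{\mu,G,J}(\mathbf{x};\epsilon):=\frac{\prod_{C\in V(J)}\widetilde\Lambda_{\otimes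 n}^{\mu_C}(\mathbf{x}_C;\epsilon)}{\prod_{\{A,B\}\in E(J)}\widetilde\Lambda_{\otimes n}^{\mu_{A\cap B}}(\mathbf{x}_{A\cap B};\epsilon)}.$$ *)

theory Defs
  imports "HOL-Probability.Probability"
begin

section \<open>Coordinate subspaces, Lebesgue measure and marginals\<close>

text \<open>
  The space \<open>\<real>\<^sup>d\<^sub>A\<close> is represented by the functions in \<open>A \<rightarrow>\<^sub>E UNIV\<close> (a value for each
  coordinate \<open>k \<in> A\<close>, \<open>undefined\<close> elsewhere), with the topology \<open>powertop_real A\<close>; the
  projection \<open>x\<^sub>A\<close> is \<open>restrict x A\<close>.
\<close>

abbreviation leb :: "'i set \<Rightarrow> ('i \<Rightarrow> real) measure" where
  "leb A \<equiv> Pi\<^sub>M A (\<lambda>_. lborel)"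

definition coord_proj :: "'i set \<Rightarrow> ('i \<Rightarrow> real) set \<Rightarrow> ('i \<Rightarrow> real) set" where
  "coord_proj A S = (\<lambda>x. restrict x A) ` S"

text \<open>
  Topological support. Only used for finite \<open>A\<close> with \<open>X = powertop_real A\<close> and \<open>M\<close> on the
  \<open>\<sigma>\<close>-algebra of \<open>leb A\<close>, which contains all open sets, so \<open>emeasure\<close> takes no junk value here.
\<close>

definition msupport :: "'a topology \<Rightarrow> 'a measure \<Rightarrow> 'a set" where
  "msupport X M = {x \<in> topspace X. \<forall>U. openin X U \<and> x \<in> U \<longrightarrow> emeasure M U > 0}"

definition marginal :: "'i set \<Rightarrow> ('i \<Rightarrow> real) measure \<Rightarrow> ('i \<Rightarrow> real) measure" where
  "marginal A \<mu> = distr \<mu> (leb A) (\<lambda>x. restrict x A)"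

text \<open>
  The marginal density \<open>f\<^sub>A\<close> of a density \<open>f\<close> on \<open>\<real>\<^sup>V\<close>, as the pointwise integral;
  \<open>merge\<close> glues \<open>x\<^sub>A\<close> and \<open>y\<close> to a point of \<open>\<real>\<^sup>V\<close>.
\<close>

definition marginal_density ::
    "'i set \<Rightarrow> (('i \<Rightarrow> real) \<Rightarrow> real) \<Rightarrow> 'i set \<Rightarrow> ('i \<Rightarrow> real) \<Rightarrow> real" where
  "marginal_density V f A x =
     (if A = {} then 1 else (LINT y|leb (V - A). f (merge A (V - A) (x, y))))"

definition locally_Lipschitz_on ::
    "'i set \<Rightarrow> ('i \<Rightarrow> real) set \<Rightarrow> (('i \<Rightarrow> real) \<Rightarrow> real) \<Rightarrow> bool" where
  "locally_Lipschitz_on A S g \<longleftrightarrow>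
     (\<forall>x\<in>S. \<exists>U L. openin (powertop_real A) U \<and> x \<in> U \<and>
        (\<forall>y\<in>U \<inter> S. \<forall>y'\<in>U \<inter> S. \<bar>g y - g y'\<bar> \<le> L * L2_set (\<lambda>k. y k - y' k) A))"

section \<open>Simple graphs\<close>

datatype 'a graph = Graph (verts: "'a set") (edges: "'a set set")

definition simple_graph :: "'a graph \<Rightarrow> bool" where
  "simple_graph G \<longleftrightarrow> edges G \<subseteq> {{u, v} | u v. u \<in> verts G \<and> v \<in> verts G \<and> u \<noteq> v}"

definition is_path :: "'a graph \<Rightarrow> 'a list \<Rightarrow> bool" where
  "is_path G p \<longleftrightarrow> p \<noteq> [] \<and> distinct p \<and> set p \<subseteq> verts G \<and>
     successively (\<lambda>u v. {u, v} \<in> edges G) p"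

definition is_cycle :: "'a graph \<Rightarrow> 'a list \<Rightarrow> bool" where
  "is_cycle G c \<longleftrightarrow> is_path G c \<and> length c \<ge> 3 \<and> {last c, hd c} \<in> edges G"

definition cycle_edges :: "'a list \<Rightarrow> 'a set set" where
  "cycle_edges c = {{c ! i, c ! (Suc i mod length c)} | i. i < length c}"

definition chordal :: "'a graph \<Rightarrow> bool" where
  "chordal G \<longleftrightarrow> (\<forall>c. is_cycle G c \<and> length c > 3 \<longrightarrow>
     (\<exists>u\<in>set c. \<exists>v\<in>set c. {u, v} \<in> edges G \<and> {u, v} \<notin> cycle_edges c))"

definition chordal_completion :: "'a graph \<Rightarrow> 'a graph \<Rightarrow> bool" where
  "chordal_completion G H \<longleftrightarrow>
     simple_graph H \<and> chordal H \<and> verts H = verts G \<and> edges G \<subseteq> edges H"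

definition is_clique :: "'a graph \<Rightarrow> 'a set \<Rightarrow> bool" where
  "is_clique G K \<longleftrightarrow> K \<subseteq> verts G \<and> (\<forall>u\<in>K. \<forall>v\<in>K. u \<noteq> v \<longrightarrow> {u, v} \<in> edges G)"

definition maximal_cliques :: "'a graph \<Rightarrow> 'a set set" where
  "maximal_cliques G = {K. is_clique G K \<and> (\<forall>K'. is_clique G K' \<and> K \<subseteq> K' \<longrightarrow> K' = K)}"

definition is_tree :: "'a graph \<Rightarrow> bool" where
  "is_tree T \<longleftrightarrow> simple_graph T \<and> verts T \<noteq> {} \<and>
     (\<forall>u\<in>verts T. \<forall>v\<in>verts T. \<exists>p. is_path T p \<and> hd p = u \<and> last p = v) \<and>
     (\<nexists>c. is_cycle T c)"

definition junction_tree :: "'a graph \<Rightarrow> 'a set graph \<Rightarrow> bool" where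
  "junction_tree G J \<longleftrightarrow> is_tree J \<and>
     (\<exists>H. chordal_completion G H \<and> verts J = maximal_cliques H) \<and>
     (\<forall>p. is_path J p \<longrightarrow> (\<forall>C\<in>set p. hd p \<inter> last p \<subseteq> C))"

definition separated :: "'a graph \<Rightarrow> 'a set \<Rightarrow> 'a set \<Rightarrow> 'a set \<Rightarrow> bool" where
  "separated G A B C \<longleftrightarrow>
     (\<forall>p. is_path G p \<and> hd p \<in> A \<and> last p \<in> B \<longrightarrow> set p \<inter> C \<noteq> {})"

section \<open>Graphical models\<close>

definition cond_indep ::
    "'i set \<Rightarrow> (('i \<Rightarrow> real) \<Rightarrow> real) \<Rightarrow> 'i set \<Rightarrow> 'i set \<Rightarrow> 'i set \<Rightarrow> bool" where
  "cond_indep V f A B C \<longleftrightarrow>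
     (let m = (\<lambda>D x. marginal_density V f D (restrict x D)) in
      AE x in leb V. m C x * m (A \<union> B \<union> C) x = m (A \<union> C) x * m (B \<union> C) x)"

definition graphical_model ::
    "'i set \<Rightarrow> (('i \<Rightarrow> real) \<Rightarrow> real) \<Rightarrow> 'i graph \<Rightarrow> bool" where
  "graphical_model V f G \<longleftrightarrow> simple_graph G \<and> verts G = V \<and>
     (\<forall>A B C. A \<subseteq> V \<and> B \<subseteq> V \<and> C \<subseteq> V \<and> separated G A B C \<longrightarrow> cond_indep V f A B C)"

section \<open>Regularized Christoffel functions\<close>

definition tensor_polys :: "nat \<Rightarrow> 'i set \<Rightarrow> (('i \<Rightarrow> real) \<Rightarrow> real) set" where
  "tensor_polys n D = range (\<lambda>(c :: ('i \<Rightarrow> nat) \<Rightarrow> real) x.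
     \<Sum>\<alpha>\<in>D \<rightarrow>\<^sub>E {..n}. c \<alpha> * (\<Prod>k\<in>D. x k ^ \<alpha> k))"

text \<open>Note the convention: \<open>\<epsilon>\<close> is the diameter, not the radius.\<close>

definition cube :: "'i set \<Rightarrow> ('i \<Rightarrow> real) \<Rightarrow> real \<Rightarrow> ('i \<Rightarrow> real) set" where
  "cube D z \<epsilon> = {x \<in> D \<rightarrow>\<^sub>E UNIV. \<forall>k\<in>D. \<bar>x k - z k\<bar> \<le> \<epsilon> / 2}"

text \<open>
  \<open>\<nu>\<close> is a measure on \<open>\<real>\<^sup>D\<close>. If \<open>\<nu>\<close> has finite moments, a nonnegative quadratic form is
  minimized over a nonempty affine subspace of a finite-dimensional space (the constant 1 is
  feasible), so the minimum is attained and equals \<open>Inf\<close>.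
\<close>

definition reg_christoffel ::
    "'i set \<Rightarrow> ('i \<Rightarrow> real) measure \<Rightarrow> nat \<Rightarrow> ('i \<Rightarrow> real) \<Rightarrow> real \<Rightarrow> real" where
  "reg_christoffel D \<nu> n z \<epsilon> =
     (if D = {} then 1
      else inverse (Inf {LINT x|\<nu>. (p x)\<^sup>2 | p. p \<in> tensor_polys n D \<and>
                          (LINT y:cube D z \<epsilon>|leb D. p y / \<epsilon> ^ card D) = 1}))"

text \<open>For an edge \<open>e = {A, B}\<close> of the junction tree, \<open>\<Inter>e = A \<inter> B\<close>.\<close>

definition reg_rational_christoffel ::
    "('i \<Rightarrow> real) measure \<Rightarrow> 'i set graph \<Rightarrow> nat \<Rightarrow> ('i \<Rightarrow> real) \<Rightarrow> real \<Rightarrow> real" where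
  "reg_rational_christoffel \<mu> J n x \<epsilon> =
     (let \<Lambda> = (\<lambda>D. reg_christoffel D (marginal D \<mu>) n (restrict x D) \<epsilon>) in
      (\<Prod>C\<in>verts J. \<Lambda> C) / (\<Prod>e\<in>edges J. \<Lambda> (\<Inter>e)))"

end

theory Submission
  imports Defs
begin

text \<open>
  The regularized Christoffel function of a set \<open>D\<close> of coordinates is the inverse of a least-squares
  problem: minimize the \<open>L\<^sup>2(\<mu>\<^sub>D)\<close> norm of a polynomial whose average over the cube \<open>Q\<close> of side
  \<open>\<epsilon>\<close> around \<open>z\<^sub>D\<close> is 1. Where the density \<open>f\<^sub>D\<close> is positive on \<open>Q\<close>, the averaging functional
  is the inner product in \<open>L\<^sup>2(\<mu>\<^sub>D)\<close> with \<open>h = 1\<^sub>Q / (\<epsilon>\<^bsup>|D|\<^esup> f\<^sub>D)\<close>. Hence the minimum over all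
  of \<open>L\<^sup>2\<close> is the inverse of \<open>N = \<parallel>h\<parallel>\<^sup>2 = \<epsilon>\<^bsup>-2|D|\<^esup> \<integral>\<^sub>Q 1 / f\<^sub>D\<close>, and because polynomials
  are dense in \<open>L\<^sup>2\<close> of a compactly supported measure, the Christoffel functions converge to \<open>N\<close> as
  the degree grows (\<open>reg_christoffel_tendsto\<close>). The quantity \<open>\<epsilon>\<^bsup>|D|\<^esup> N\<close> is the mean of
  \<open>1 / f\<^sub>D\<close> over \<open>Q\<close>, so a Lipschitz bound for \<open>f\<^sub>D\<close> gives
  \<open>(\<epsilon>\<^bsup>|D|\<^esup> N)\<^sup>-\<^sup>1 = f\<^sub>D(z\<^sub>D) + O(\<epsilon>)\<close> (\<open>christoffel_asymptotics\<close>).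

  It remains to combine these limits over the junction tree, for which two identities are needed:
  \<open>f(z) \<Prod>\<^sub>S f\<^sub>S(z\<^sub>S) = \<Prod>\<^sub>C f\<^sub>C(z\<^sub>C)\<close> and \<open>d + \<Sum>\<^sub>S |S| = \<Sum>\<^sub>C |C|\<close>, with \<open>C\<close> ranging over the
  nodes and \<open>S\<close> over the intersections along the edges. Both (the second
  one as an identity of powers of \<open>\<epsilon>\<close>) are instances of \<open>junction_tree_factorization\<close>: a function \<open>\<phi>\<close> of vertex sets that satisfies
  \<open>\<phi> C * \<phi> (A \<union> B \<union> C) = \<phi> (A \<union> C) * \<phi> (B \<union> C)\<close> whenever \<open>C\<close> separates \<open>A\<close> from \<open>B\<close> factors
  along the tree. This is proved by growing the tree node by node, since \<open>A \<inter> B\<close> separates a new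
  node \<open>B\<close> with neighbour \<open>A\<close> from everything added before. For the marginals the hypothesis is
  conditional independence; it holds almost everywhere, and continuity transfers it to the point
  \<open>z\<close> (\<open>cond_indep_pointwise\<close>).
\<close>

section \<open>Factorization along a junction tree\<close>

text \<open>
  If the new vertex already lies on the path, the path is cut off there.
\<close>
lemma path_extend:
  assumes p: "is_path T p" "last p = v" and e: "{v, w} \<in> edges T" and w: "w \<in> verts T"
  shows "\<exists>q. is_path T q \<and> hd q = hd p \<and> last q = w \<and> set q \<subseteq> insert w (set p)"
proof (cases "w \<in> set p")
  case True
  then obtain xs ys where xy: "p = xs @ w # ys" by (meson split_list)
  have "is_path T (xs @ [w])"
    using p(1) unfolding is_path_def xy by (auto simp: successively_append_iff)
  then show ?thesis
    by (intro exI[of _ "xs @ [w]"]) (auto simp: xy hd_append)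
next
  case False
  have "is_path T (p @ [w])"
    using p e w False unfolding is_path_def by (auto simp: successively_append_iff)
  then show ?thesis
    using p(1) by (intro exI[of _ "p @ [w]"]) (auto simp: is_path_def)
qed

lemma walk_imp_path:
  assumes "(u, v) \<in> {(x, y). {x, y} \<in> edges T \<and> x \<in> S \<and> y \<in> S}\<^sup>*"
    and "u \<in> S" "S \<subseteq> verts T"
  shows "\<exists>p. is_path T p \<and> hd p = u \<and> last p = v \<and> set p \<subseteq> S"
  using assms(1)
proof (induction rule: rtrancl_induct)
  case base
  show ?case using assms by (intro exI[of _ "[u]"]) (auto simp: is_path_def)
next
  case (step y w)
  then obtain p where p: "is_path T p" "hd p = u" "last p = y" "set p \<subseteq> S" by auto
  have w: "{y, w} \<in> edges T" "w \<in> S" using step.hyps(2) by auto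
  then obtain q where "is_path T q" "hd q = hd p" "last q = w" "set q \<subseteq> insert w (set p)"
    using path_extend[OF p(1,3) w(1)] assms(3) by blast
  with p(2,4) w(2) show ?case by blast
qed

lemma path_imp_walk:
  assumes "successively (\<lambda>u v. {u, v} \<in> E) p" "set p \<subseteq> S" "p \<noteq> []"
  shows "(hd p, last p) \<in> {(x, y). {x, y} \<in> E \<and> x \<in> S \<and> y \<in> S}\<^sup>*"
  using assms
proof (induction p rule: induct_list012)
  case (3 x y zs)
  let ?R = "{(x, y). {x, y} \<in> E \<and> x \<in> S \<and> y \<in> S}"
  have "(x, y) \<in> ?R" using "3.prems" by simp
  moreover have "(y, last (y # zs)) \<in> ?R\<^sup>*" using 3 by (simp only: list.sel) simp
  ultimately have "(x, last (y # zs)) \<in> ?R\<^sup>*" by (rule converse_rtrancl_into_rtrancl)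
  moreover have "hd (x # y # zs) = x" "last (x # y # zs) = last (y # zs)" by simp_all
  ultimately show ?case by (simp only:)
qed simp_all

lemma path_rev: "is_path T p \<Longrightarrow> is_path T (rev p)"
  by (simp add: is_path_def insert_commute)

definition linked_in :: "'a graph \<Rightarrow> 'a set \<Rightarrow> bool" where
  "linked_in T S \<longleftrightarrow> (\<forall>u\<in>S. \<forall>v\<in>S. \<exists>p. is_path T p \<and> hd p = u \<and> last p = v \<and> set p \<subseteq> S)"

definition edges_in :: "'a graph \<Rightarrow> 'a set \<Rightarrow> 'a set set" where
  "edges_in T S = {e \<in> edges T. e \<subseteq> S}"

lemma linked_in_insert:
  assumes S: "linked_in T S" "S \<subseteq> verts T" and a: "a \<in> S" and b: "b \<in> verts T" and e: "{a, b} \<in> edges T"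
  shows "linked_in T (insert b S)"
proof -
  have to_b: "\<exists>p. is_path T p \<and> hd p = u \<and> last p = b \<and> set p \<subseteq> insert b S" if u: "u \<in> S" for u
  proof -
    obtain p where p: "is_path T p" "hd p = u" "last p = a" "set p \<subseteq> S"
      using S(1) a u unfolding linked_in_def by blast
    obtain q where "is_path T q" "hd q = hd p" "last q = b" "set q \<subseteq> insert b (set p)"
      using path_extend[OF p(1,3) e b] by blast
    with p(2,4) show ?thesis by (intro exI[of _ q]) auto
  qed
  have from_b: "\<exists>p. is_path T p \<and> hd p = b \<and> last p = u \<and> set p \<subseteq> insert b S" if u: "u \<in> S" for u
  proof -
    obtain p where p: "is_path T p" "hd p = u" "last p = b" "set p \<subseteq> insert b S"
      using to_b u by blast
    then show ?thesis
      using path_rev[OF p(1)] by (intro exI[of _ "rev p"]) (simp add: hd_rev last_rev)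
  qed
  have bb: "\<exists>p. is_path T p \<and> hd p = b \<and> last p = b \<and> set p \<subseteq> insert b S"
    using b by (intro exI[of _ "[b]"]) (auto simp: is_path_def)
  have inside: "\<exists>p. is_path T p \<and> hd p = u \<and> last p = v \<and> set p \<subseteq> insert b S"
    if uv: "u \<in> S" "v \<in> S" for u v
  proof -
    obtain p where "is_path T p" "hd p = u" "last p = v" "set p \<subseteq> S"
      using S(1) uv unfolding linked_in_def by blast
    then show ?thesis by (intro exI[of _ p]) auto
  qed
  show ?thesis
    unfolding linked_in_def
  proof (intro ballI)
    fix u v assume "u \<in> insert b S" "v \<in> insert b S"
    then consider "u = b" "v = b" | "u = b" "v \<in> S" | "u \<in> S" "v = b" | "u \<in> S" "v \<in> S" by auto
    then show "\<exists>p. is_path T p \<and> hd p = u \<and> last p = v \<and> set p \<subseteq> insert b S"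
      by cases (simp_all only: bb to_b from_b inside)
  qed
qed

text \<open>
  A second edge from \<open>b\<close> into the connected set \<open>S\<close> would close a cycle through \<open>a\<close>.
\<close>
lemma edges_in_insert:
  assumes T: "is_tree T" and S: "linked_in T S" "S \<subseteq> verts T"
    and a: "a \<in> S" and b: "b \<in> verts T - S" and e: "{a, b} \<in> edges T"
  shows "edges_in T (insert b S) = insert {a, b} (edges_in T S)"
proof -
  have sg: "edges T \<subseteq> {{u, v} | u v. u \<in> verts T \<and> v \<in> verts T \<and> u \<noteq> v}"
    using T by (auto simp: is_tree_def simple_graph_def)
  have "c = a" if c: "c \<in> S" "{c, b} \<in> edges T" for c
  proof (rule ccontr)
    assume "c \<noteq> a"
    obtain p where p: "is_path T p" "hd p = a" "last p = c" "set p \<subseteq> S"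
      using S(1) a c unfolding linked_in_def by blast
    have len: "length p \<ge> 2"
      using p \<open>c \<noteq> a\<close> by (cases p rule: list.exhaust; cases "tl p") (auto simp: is_path_def)
    have bp: "b \<notin> set p" using p b by auto
    have pn: "p \<noteq> []" using len by auto
    have "is_path T (p @ [b])"
      using p c b bp unfolding is_path_def by (auto simp: successively_append_iff)
    moreover have "{last (p @ [b]), hd (p @ [b])} \<in> edges T"
      using e pn p by (simp add: insert_commute)
    ultimately have "is_cycle T (p @ [b])"
      using len by (simp add: is_cycle_def)
    then show False using T by (auto simp: is_tree_def)
  qed
  note unique = this
  have *: "f = {a, b} \<or> f \<subseteq> S" if f: "f \<in> edges T" "f \<subseteq> insert b S" for f
  proof -
    obtain u v where uv: "f = {u, v}" "u \<noteq> v" using sg f(1) by blast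
    then consider "u = b" "v \<in> S" | "v = b" "u \<in> S" | "u \<in> S" "v \<in> S" using f(2) by auto
    then show ?thesis
    proof cases
      case 1
      then have "v = a" using unique[of v] f(1) uv(1) by (simp add: insert_commute)
      with 1 uv show ?thesis by (simp add: insert_commute)
    next
      case 2
      then have "u = a" using unique[of u] f(1) uv(1) by simp
      with 2 uv show ?thesis by simp
    qed (use uv in simp)
  qed
  show ?thesis
  proof (rule set_eqI)
    fix f show "f \<in> edges_in T (insert b S) \<longleftrightarrow> f \<in> insert {a, b} (edges_in T S)"
      using *[of f] e a by (auto simp: edges_in_def)
  qed
qed

text \<open>
  A tree can be built from a single node by repeatedly attaching a node adjacent to the connected part
  built so far; acyclicity (\<open>edges_in_insert\<close>) makes each step add exactly one edge.
\<close>
lemma tree_induct [consumes 2, case_names singleton grow]: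
  assumes T: "is_tree T" and fin: "finite (verts T)"
    and base: "\<And>r. r \<in> verts T \<Longrightarrow> P {r}"
    and step: "\<And>S a b. S \<subseteq> verts T \<Longrightarrow> linked_in T S \<Longrightarrow> P S \<Longrightarrow> a \<in> S \<Longrightarrow> b \<in> verts T - S \<Longrightarrow>
        {a, b} \<in> edges T \<Longrightarrow> P (insert b S)"
  shows "P (verts T)"
proof -
  obtain r where r: "r \<in> verts T" using T by (auto simp: is_tree_def)
  define \<S> where "\<S> = {S. S \<subseteq> verts T \<and> r \<in> S \<and> linked_in T S \<and> P S}"
  have "{r} \<in> \<S>"
    using r base by (auto simp: \<S>_def linked_in_def is_path_def intro!: exI[of _ "[r]"])
  moreover have "finite \<S>"
    by (rule finite_subset[of _ "Pow (verts T)"]) (auto simp: \<S>_def fin)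
  ultimately obtain S where S: "S \<in> \<S>" and max: "\<And>S'. S' \<in> \<S> \<Longrightarrow> S \<subseteq> S' \<Longrightarrow> S' = S"
    by (metis empty_iff finite_has_maximal)
  have "S = verts T"
  proof (rule ccontr)
    assume "S \<noteq> verts T"
    then obtain v where v: "v \<in> verts T" "v \<notin> S" using S by (auto simp: \<S>_def)
    then obtain p where p: "is_path T p" "hd p = r" "last p = v"
      using T r unfolding is_tree_def by blast
    have walk: "(r, v) \<in> {(x, y). {x, y} \<in> edges T \<and> x \<in> verts T \<and> y \<in> verts T}\<^sup>*"
      using path_imp_walk[of "edges T" p "verts T"] p by (auto simp: is_path_def)
    have "\<exists>a b. a \<in> S \<and> b \<in> verts T - S \<and> {a, b} \<in> edges T"
    proof (rule ccontr)
      assume n: "\<not> ?thesis"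
      have "v \<in> S"
        using walk by (induction rule: rtrancl_induct) (use n S in \<open>auto simp: \<S>_def\<close>)
      with v show False by auto
    qed
    then obtain a b where ab: "a \<in> S" "b \<in> verts T - S" "{a, b} \<in> edges T" by blast
    have "insert b S \<in> \<S>"
      using step[of S a b] linked_in_insert[of T S a b] ab S by (auto simp: \<S>_def)
    then show False using max[of "insert b S"] ab by auto
  qed
  then show ?thesis using S by (auto simp: \<S>_def)
qed

text \<open>
  If no edge joins \<open>X - Y\<close> to \<open>Y - X\<close>, a path from \<open>X\<close> to \<open>Y\<close> that avoids \<open>X \<inter> Y\<close> can never
  leave \<open>X\<close>.
\<close>
lemma separatedI:
  assumes cover: "\<And>u v. {u, v} \<in> edges G \<Longrightarrow> {u, v} \<subseteq> X \<or> {u, v} \<subseteq> Y"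
    and "A \<subseteq> X" "B \<subseteq> Y" "X \<inter> Y \<subseteq> C"
  shows "separated G A B C"
  unfolding separated_def
proof (intro allI impI notI)
  fix p assume p: "is_path G p \<and> hd p \<in> A \<and> last p \<in> B" and C: "set p \<inter> C = {}"
  have "successively (\<lambda>u v. {u, v} \<in> edges G) p" "p \<noteq> []" "hd p \<in> X"
    using p assms by (auto simp: is_path_def)
  then have "last p \<in> X" using C
  proof (induction p rule: induct_list012)
    case (3 x y zs)
    then show ?case using cover[of x y] assms(4) by auto
  qed auto
  moreover have "last p \<in> set p" "last p \<in> Y" using p assms by (auto simp: is_path_def)
  ultimately show False using assms(4) C by auto
qed

lemma clique_extends:
  assumes "finite (verts H)" "is_clique H K"
  shows "\<exists>K'\<in>maximal_cliques H. K \<subseteq> K'"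
proof -
  have "finite {K'. is_clique H K' \<and> K \<subseteq> K'}"
    by (rule finite_subset[of _ "Pow (verts H)"]) (use assms(1) in \<open>auto simp: is_clique_def\<close>)
  then obtain M where M: "M \<in> {K'. is_clique H K' \<and> K \<subseteq> K'}"
      "\<And>K'. K' \<in> {K'. is_clique H K' \<and> K \<subseteq> K'} \<Longrightarrow> M \<subseteq> K' \<Longrightarrow> K' = M"
    using assms(2) finite_has_maximal[of "{K'. is_clique H K' \<and> K \<subseteq> K'}"]
    by (metis (mono_tags, lifting) empty_iff mem_Collect_eq subset_refl)
  then show ?thesis by (intro bexI[of _ M]) (auto simp: maximal_cliques_def)
qed

lemma junction_tree_cliques:
  assumes J: "junction_tree G J" and fin: "finite (verts G)" and sg: "simple_graph G"
  shows "verts J \<subseteq> Pow (verts G)" "\<Union>(verts J) = verts G"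
    and "\<And>u v. {u, v} \<in> edges G \<Longrightarrow> \<exists>C\<in>verts J. {u, v} \<subseteq> C"
proof -
  obtain H where H: "chordal_completion G H" "verts J = maximal_cliques H"
    using J by (auto simp: junction_tree_def)
  have v: "verts H = verts G" "edges G \<subseteq> edges H" using H by (auto simp: chordal_completion_def)
  show 1: "verts J \<subseteq> Pow (verts G)"
    using H v by (auto simp: maximal_cliques_def is_clique_def)
  have "\<exists>C\<in>verts J. u \<in> C" if "u \<in> verts G" for u
    using clique_extends[of H "{u}"] that H v fin by (auto simp: is_clique_def)
  with 1 show "\<Union>(verts J) = verts G" by blast
  fix u v assume uv: "{u, v} \<in> edges G"
  then obtain a b where "{u, v} = {a, b}" "a \<in> verts G" "b \<in> verts G"
    using sg unfolding simple_graph_def by blast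
  then have "u \<in> verts G" "v \<in> verts G" by (auto simp: doubleton_eq_iff)
  then have "is_clique H {u, v}"
    using v uv by (auto simp: is_clique_def insert_commute)
  then show "\<exists>C\<in>verts J. {u, v} \<subseteq> C"
    using clique_extends[of H "{u,v}"] H v fin by auto
qed

text \<open>
  Deleting the edge between \<open>A\<close> and \<open>B\<close> splits the tree into the nodes \<open>Y\<close> that reach \<open>A\<close> without
  passing through \<open>B\<close>, and the rest \<open>X\<close>. A path from \<open>X\<close> to \<open>Y\<close> passes through \<open>B\<close>, and prolonging a
  path from \<open>Y\<close> to \<open>A\<close> by the node \<open>B\<close> gives a path through \<open>A\<close> that ends in \<open>B\<close>; so the clique
  intersection property puts every common vertex of \<open>\<Union>X\<close> and \<open>\<Union>Y\<close> first into \<open>B\<close> and then into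
  \<open>A\<close>.
\<close>
lemma junction_tree_split:
  assumes J: "junction_tree G J"
    and S: "linked_in J S" "S \<subseteq> verts J"
    and A: "A \<in> S" and B: "B \<in> verts J - S" and e: "{A, B} \<in> edges J"
  obtains X Y where "verts J = X \<union> Y" "B \<in> X" "S \<subseteq> Y" "\<Union>X \<inter> \<Union>Y \<subseteq> A \<inter> B"
proof -
  define R where "R = {(x, y). {x, y} \<in> edges J \<and> x \<in> verts J - {B} \<and> y \<in> verts J - {B}}"
  define Y where "Y = {D \<in> verts J - {B}. (D, A) \<in> R\<^sup>*}"
  have cip: "hd p \<inter> last p \<subseteq> C" if "is_path J p" "C \<in> set p" for p C
    using J that by (auto simp: junction_tree_def)
  have conn: "\<exists>p. is_path J p \<and> hd p = u \<and> last p = v" if "u \<in> verts J" "v \<in> verts J" for u v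
    using J that by (auto simp: junction_tree_def is_tree_def)
  have SY: "S \<subseteq> Y"
  proof
    fix D assume D: "D \<in> S"
    obtain p where p: "is_path J p" "hd p = D" "last p = A" "set p \<subseteq> S"
      using S(1) A D unfolding linked_in_def by blast
    have "set p \<subseteq> verts J - {B}" using p S B by auto
    then have "(hd p, last p) \<in> R\<^sup>*"
      using p path_imp_walk[of "edges J" p "verts J - {B}"] unfolding R_def is_path_def by blast
    then show "D \<in> Y" using p D S B by (auto simp: Y_def)
  qed
  have EB: "E \<inter> B \<subseteq> A" if E: "E \<in> Y" for E
  proof -
    obtain p where p: "is_path J p" "hd p = E" "last p = A" "set p \<subseteq> verts J - {B}"
      using walk_imp_path[of E A J "verts J - {B}"] E unfolding Y_def R_def by auto
    have "is_path J (p @ [B])"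
      using p e B unfolding is_path_def by (auto simp: successively_append_iff)
    moreover have "A \<in> set p" using p by (metis is_path_def last_in_set)
    ultimately show ?thesis using cip[of "p @ [B]" A] p by (auto simp: is_path_def)
  qed
  have "\<Union>(verts J - Y) \<inter> \<Union>Y \<subseteq> A \<inter> B"
  proof safe
    fix x D E assume D: "D \<in> verts J" "x \<in> D" "D \<notin> Y" and E: "E \<in> Y" "x \<in> E"
    have "x \<in> B"
    proof (cases "D = B")
      case False
      obtain p where p: "is_path J p" "hd p = D" "last p = E"
        using conn[of D E] D E by (auto simp: Y_def)
      have "B \<in> set p"
      proof (rule ccontr)
        assume "B \<notin> set p"
        then have "(D, E) \<in> R\<^sup>*"
          using p path_imp_walk[of "edges J" p "verts J - {B}"] unfolding R_def is_path_def by blast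
        then have "D \<in> Y" using E D False by (auto simp: Y_def intro: rtrancl_trans)
        with D show False by simp
      qed
      then show ?thesis using cip[OF p(1), of B] p D E by auto
    qed (use D in auto)
    then show "x \<in> B" "x \<in> A" using EB[of E] E by auto
  qed
  then show thesis
    using that[of "verts J - Y" Y] SY B by (auto simp: Y_def)
qed

text \<open>
  Every edge of \<open>G\<close> lies in some clique, hence in one of the two halves of \<open>junction_tree_split\<close>.
  The halves of the whole tree are used here, because a path in \<open>G\<close> may leave \<open>B \<union> \<Union>S\<close>.
\<close>
lemma junction_tree_separates:
  assumes J: "junction_tree G J" and fin: "finite (verts G)" and sg: "simple_graph G"
    and S: "linked_in J S" "S \<subseteq> verts J"
    and A: "A \<in> S" and B: "B \<in> verts J - S" and e: "{A, B} \<in> edges J"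
  shows "separated G B (\<Union>S) (A \<inter> B)"
proof -
  obtain X Y where XY: "verts J = X \<union> Y" "B \<in> X" "S \<subseteq> Y" "\<Union>X \<inter> \<Union>Y \<subseteq> A \<inter> B"
    using junction_tree_split[OF J S A B e] by blast
  show ?thesis
  proof (rule separatedI[of G "\<Union>X" "\<Union>Y"])
    fix u v assume "{u, v} \<in> edges G"
    then obtain C where "C \<in> verts J" "{u, v} \<subseteq> C"
      using junction_tree_cliques(3)[OF J fin sg] by blast
    then show "{u, v} \<subseteq> \<Union>X \<or> {u, v} \<subseteq> \<Union>Y" using XY by blast
  qed (use XY in auto)
qed

text \<open>
  Attaching a node \<open>B\<close> at \<open>A\<close> turns \<open>\<phi> (\<Union>S)\<close> into \<open>\<phi> (B \<union> \<Union>S)\<close> and adds the edge factor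
  \<open>\<phi> (A \<inter> B)\<close>; by separation the left-hand side is thereby multiplied by \<open>\<phi> B\<close>, which is the factor
  gained on the right. The identity is kept free of division, so \<open>\<phi>\<close> may vanish.
\<close>
lemma junction_tree_factorization:
  fixes \<phi> :: "'a set \<Rightarrow> 'b::idom"
  assumes J: "junction_tree G J" and fin: "finite (verts G)" and sg: "simple_graph G"
    and \<phi>: "\<And>A B C. A \<subseteq> verts G \<Longrightarrow> B \<subseteq> verts G \<Longrightarrow> C \<subseteq> verts G \<Longrightarrow> separated G A B C \<Longrightarrow>
        \<phi> C * \<phi> (A \<union> B \<union> C) = \<phi> (A \<union> C) * \<phi> (B \<union> C)"
  shows "\<phi> (verts G) * (\<Prod>e\<in>edges J. \<phi> (\<Inter>e)) = (\<Prod>C\<in>verts J. \<phi> C)"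
proof -
  have T: "is_tree J" using J by (simp add: junction_tree_def)
  have edge: "\<exists>u v. e = {u, v} \<and> u \<in> verts J \<and> v \<in> verts J \<and> u \<noteq> v" if "e \<in> edges J" for e
    using T that by (auto simp: is_tree_def simple_graph_def)
  note cl = junction_tree_cliques[OF J fin sg]
  have finJ: "finite (verts J)" using finite_subset[OF cl(1)] fin by simp
  have finE: "finite (edges_in J S)" if "S \<subseteq> verts J" for S
  proof (rule finite_subset)
    show "edges_in J S \<subseteq> Pow S" by (auto simp: edges_in_def)
  qed (use finite_subset[OF that finJ] in simp)
  have "\<phi> (\<Union>(verts J)) * (\<Prod>e\<in>edges_in J (verts J). \<phi> (\<Inter>e)) = (\<Prod>C\<in>verts J. \<phi> C)"
    using T finJ
  proof (induction rule: tree_induct)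
    case (singleton r)
    have "e = {r}" if "e \<in> edges_in J {r}" "e \<noteq> {}" for e using that by (auto simp: edges_in_def)
    then have "edges_in J {r} = {}"
      using edge by (force simp: edges_in_def)
    then show ?case by simp
  next
    case (grow S A B)
    note ji = junction_tree_separates[OF J fin sg grow.hyps(2,1,3,4,5)]
    have E: "edges_in J (insert B S) = insert {A, B} (edges_in J S)"
      by (rule edges_in_insert[OF T grow.hyps(2,1,3,4,5)])
    have nE: "{A, B} \<notin> edges_in J S" using grow.hyps by (auto simp: edges_in_def)
    have sub: "B \<subseteq> verts G" "\<Union>S \<subseteq> verts G" "A \<inter> B \<subseteq> verts G"
      using cl(1) grow.hyps by auto
    have u: "B \<union> \<Union>S \<union> A \<inter> B = \<Union>(insert B S)" "B \<union> A \<inter> B = B" "\<Union>S \<union> A \<inter> B = \<Union>S"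
      using grow.hyps by auto
    have "\<phi> (A \<inter> B) * \<phi> (\<Union>(insert B S)) = \<phi> B * \<phi> (\<Union>S)"
      using \<phi>[OF sub ji] by (simp only: u)
    then show ?case
      using grow.IH grow.hyps(4) finE[OF grow.hyps(1)] finite_subset[OF grow.hyps(1) finJ] nE
      by (simp add: E) algebra
  qed
  moreover have "edges_in J (verts J) = edges J"
    using edge by (auto simp: edges_in_def)
  ultimately show ?thesis using cl(2) by simp
qed

lemma separated_Int:
  assumes "separated G A B C" "A \<subseteq> verts G"
  shows "A \<inter> B \<subseteq> C"
proof
  fix x assume x: "x \<in> A \<inter> B"
  have "is_path G [x]" using x assms(2) by (auto simp: is_path_def)
  then have "set [x] \<inter> C \<noteq> {}"
    using assms(1)[unfolded separated_def, rule_format, of "[x]"] x by simp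
  then show "x \<in> C" by simp
qed

text \<open>
  A separator contains the intersection of the sets that it separates, so the cardinality is modular
  on separated triples and its exponential satisfies the factorization hypothesis.
\<close>
lemma junction_tree_power_card:
  fixes \<epsilon> :: "'b::idom"
  assumes J: "junction_tree G J" and fin: "finite (verts G)" and sg: "simple_graph G"
  shows "\<epsilon> ^ card (verts G) * (\<Prod>e\<in>edges J. \<epsilon> ^ card (\<Inter>e)) = (\<Prod>C\<in>verts J. \<epsilon> ^ card C)"
proof (rule junction_tree_factorization[OF J fin sg])
  fix A B C assume sub: "A \<subseteq> verts G" "B \<subseteq> verts G" "C \<subseteq> verts G" and sep: "separated G A B C"
  have "finite A" "finite B" "finite C" using sub fin finite_subset by blast+
  moreover have "(A \<union> C) \<inter> (B \<union> C) = C" using separated_Int[OF sep sub(1)] by blast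
  moreover have "(A \<union> C) \<union> (B \<union> C) = A \<union> B \<union> C" by blast
  ultimately have "card (A \<union> C) + card (B \<union> C) = card (A \<union> B \<union> C) + card C"
    using card_Un_Int[of "A \<union> C" "B \<union> C"] by simp
  then show "\<epsilon> ^ card C * \<epsilon> ^ card (A \<union> B \<union> C) = \<epsilon> ^ card (A \<union> C) * \<epsilon> ^ card (B \<union> C)"
    unfolding power_add[symmetric] by (simp add: add.commute)
qed

section \<open>Polynomials of bounded degree in each variable\<close>

lemma tensor_poly_add:
  assumes "p \<in> tensor_polys n D" "q \<in> tensor_polys n D"
  shows "(\<lambda>x. p x + q x) \<in> tensor_polys n D"
proof -
  obtain c c' where "p = (\<lambda>x. \<Sum>\<alpha>\<in>D \<rightarrow>\<^sub>E {..n}. c \<alpha> * (\<Prod>k\<in>D. x k ^ \<alpha> k))"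
    "q = (\<lambda>x. \<Sum>\<alpha>\<in>D \<rightarrow>\<^sub>E {..n}. c' \<alpha> * (\<Prod>k\<in>D. x k ^ \<alpha> k))"
    using assms by (auto simp: tensor_polys_def)
  then show ?thesis
    unfolding tensor_polys_def
    by (intro range_eqI[of _ _ "\<lambda>\<alpha>. c \<alpha> + c' \<alpha>"]) (simp add: sum.distrib distrib_right)
qed

lemma tensor_poly_scale:
  assumes "p \<in> tensor_polys n D" shows "(\<lambda>x. a * p x) \<in> tensor_polys n D"
proof -
  obtain c where "p = (\<lambda>x. \<Sum>\<alpha>\<in>D \<rightarrow>\<^sub>E {..n}. c \<alpha> * (\<Prod>k\<in>D. x k ^ \<alpha> k))"
    using assms by (auto simp: tensor_polys_def)
  then show ?thesis
    unfolding tensor_polys_def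
    by (intro range_eqI[of _ _ "\<lambda>\<alpha>. a * c \<alpha>"]) (simp add: sum_distrib_left mult.assoc)
qed

lemma tensor_poly_zero: "(\<lambda>x. 0) \<in> tensor_polys n D"
  unfolding tensor_polys_def by (intro range_eqI[of _ _ "\<lambda>\<alpha>. 0"]) simp

lemma tensor_poly_sum:
  assumes "finite I" "\<And>i. i \<in> I \<Longrightarrow> p i \<in> tensor_polys n D"
  shows "(\<lambda>x. \<Sum>i\<in>I. p i x) \<in> tensor_polys n D"
  using assms
proof (induction I rule: finite_induct)
  case (insert i I)
  then show ?case using tensor_poly_add[of "p i" n D "\<lambda>x. \<Sum>i\<in>I. p i x"] by simp
qed (simp add: tensor_poly_zero)

lemma tensor_poly_monomial:
  assumes D: "finite D" and \<gamma>: "\<And>k. k \<in> D \<Longrightarrow> \<gamma> k \<le> n"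
  shows "(\<lambda>x. \<Prod>k\<in>D. x k ^ \<gamma> k) \<in> tensor_polys n D"
proof -
  have fin: "finite (D \<rightarrow>\<^sub>E {..n})" using D by (simp add: finite_PiE)
  have mem: "\<gamma> \<in> D \<rightarrow> {..n}" using \<gamma> by auto
  have "(\<Sum>\<alpha>\<in>D \<rightarrow>\<^sub>E {..n}. (if \<alpha> = restrict \<gamma> D then 1 else 0) * (\<Prod>k\<in>D. x k ^ \<alpha> k))
      = (\<Prod>k\<in>D. x k ^ \<gamma> k)" for x :: "'a \<Rightarrow> real"
    by (simp add: if_distrib[of "\<lambda>c. c * _"] sum.delta[OF fin] mem cong: if_cong prod.cong)
  then show ?thesis
    unfolding tensor_polys_def by (intro range_eqI[of _ _ "\<lambda>\<alpha>. if \<alpha> = restrict \<gamma> D then 1 else 0"]) simp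
qed

lemma tensor_poly_const: "finite D \<Longrightarrow> (\<lambda>x. a) \<in> tensor_polys n D"
  using tensor_poly_scale[OF tensor_poly_monomial[of D "\<lambda>_. 0" n], of a] by simp

lemma tensor_poly_coordinate:
  assumes "finite D" "i \<in> D" shows "(\<lambda>x. x i) \<in> tensor_polys 1 D"
proof -
  have "(\<Prod>k\<in>D. x k ^ (if k = i then 1 else 0)) = x i" for x :: "'a \<Rightarrow> real"
    using assms by (simp add: if_distrib[of "\<lambda>c. _ ^ c"] prod.delta cong: if_cong)
  then show ?thesis
    using tensor_poly_monomial[of D "\<lambda>k. if k = i then 1 else 0" 1] assms by simp
qed

lemma tensor_poly_mult:
  assumes D: "finite D" and "p \<in> tensor_polys n D" "q \<in> tensor_polys m D"
  shows "(\<lambda>x. p x * q x) \<in> tensor_polys (n + m) D"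
proof -
  obtain c c' where pq: "p = (\<lambda>x. \<Sum>\<alpha>\<in>D \<rightarrow>\<^sub>E {..n}. c \<alpha> * (\<Prod>k\<in>D. x k ^ \<alpha> k))"
    "q = (\<lambda>x. \<Sum>\<beta>\<in>D \<rightarrow>\<^sub>E {..m}. c' \<beta> * (\<Prod>k\<in>D. x k ^ \<beta> k))"
    using assms by (auto simp: tensor_polys_def)
  have "p x * q x = (\<Sum>\<alpha>\<in>D \<rightarrow>\<^sub>E {..n}. \<Sum>\<beta>\<in>D \<rightarrow>\<^sub>E {..m}. (c \<alpha> * c' \<beta>) * (\<Prod>k\<in>D. x k ^ (\<alpha> k + \<beta> k)))" for x
    unfolding pq sum_product by (intro sum.cong refl) (simp add: power_add prod.distrib mult_ac)
  moreover have "(\<lambda>x. \<Sum>\<alpha>\<in>D \<rightarrow>\<^sub>E {..n}. \<Sum>\<beta>\<in>D \<rightarrow>\<^sub>E {..m}.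
      (c \<alpha> * c' \<beta>) * (\<Prod>k\<in>D. x k ^ (\<alpha> k + \<beta> k))) \<in> tensor_polys (n + m) D"
    using D by (intro tensor_poly_sum tensor_poly_scale tensor_poly_monomial finite_PiE)
       (auto simp: PiE_iff intro!: add_mono)
  ultimately show ?thesis by simp
qed

lemma tensor_poly_mono:
  assumes "finite D" "n \<le> m" shows "tensor_polys n D \<subseteq> tensor_polys m D"
proof
  fix p assume "p \<in> tensor_polys n D"
  then have "(\<lambda>x. p x * 1) \<in> tensor_polys (n + (m - n)) D"
    using assms by (intro tensor_poly_mult tensor_poly_const) auto
  then show "p \<in> tensor_polys m D" using assms by simp
qed

lemma tensor_poly_continuous: "p \<in> tensor_polys n D \<Longrightarrow> continuous_on S p"
  unfolding tensor_polys_def by (auto intro!: continuous_intros continuous_on_product_then_coordinatewise[OF continuous_on_id])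

lemma tensor_poly_measurable:
  assumes "p \<in> tensor_polys n D" shows "p \<in> borel_measurable (leb D)"
  using assms unfolding tensor_polys_def by (auto intro!: borel_measurable_sum borel_measurable_times borel_measurable_prod borel_measurable_power measurable_component_singleton[where M="\<lambda>_. lborel", simplified])

lemma tensor_poly_bounded:
  assumes D: "finite D" and p: "p \<in> tensor_polys n D"
  obtains K where "\<And>x. (\<And>k. k \<in> D \<Longrightarrow> \<bar>x k\<bar> \<le> R) \<Longrightarrow> \<bar>p x\<bar> \<le> K"
proof -
  obtain c where c: "p = (\<lambda>x. \<Sum>\<alpha>\<in>D \<rightarrow>\<^sub>E {..n}. c \<alpha> * (\<Prod>k\<in>D. x k ^ \<alpha> k))"
    using p by (auto simp: tensor_polys_def)
  have "\<bar>p x\<bar> \<le> (\<Sum>\<alpha>\<in>D \<rightarrow>\<^sub>E {..n}. \<bar>c \<alpha>\<bar> * (\<Prod>k\<in>D. R ^ \<alpha> k))"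
    if "\<And>k. k \<in> D \<Longrightarrow> \<bar>x k\<bar> \<le> R" for x
    unfolding c using that
    by (intro order.trans[OF sum_abs] sum_mono)
       (auto simp: abs_mult abs_prod power_abs intro!: mult_left_mono prod_mono power_mono)
  then show thesis by (rule that)
qed

text \<open>
  Stone--Weierstrass on the box \<open>[-R, R]\<^bsup>D\<^esup>\<close>. The box is realized inside the full function space by
  fixing all coordinates outside \<open>D\<close> to \<open>undefined\<close>, which makes it compact by Tychonoff's theorem
  and lets the coordinates in \<open>D\<close> separate its points.
\<close>
lemma tensor_poly_dense:
  fixes D :: "'i::countable set" and h :: "('i \<Rightarrow> real) \<Rightarrow> real"
  assumes D: "finite D" and h: "continuous_on UNIV h" and e: "e > 0"
  obtains n p where "p \<in> tensor_polys n D"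
    "\<And>x. x \<in> D \<rightarrow>\<^sub>E UNIV \<Longrightarrow> (\<And>k. k \<in> D \<Longrightarrow> \<bar>x k\<bar> \<le> R) \<Longrightarrow> \<bar>h x - p x\<bar> < e"
proof -
  define S :: "('i \<Rightarrow> real) set" where "S = (\<Pi>\<^sub>E i\<in>UNIV. if i \<in> D then {-R..R} else {undefined})"
  have S: "x \<in> S" if "x \<in> D \<rightarrow>\<^sub>E UNIV" "\<And>k. k \<in> D \<Longrightarrow> \<bar>x k\<bar> \<le> R" for x
    using that by (auto simp: S_def PiE_iff extensional_def abs_le_iff) (smt (verit))
  have "compactin (product_topology (\<lambda>_. euclidean) UNIV) S"
    unfolding S_def by (subst compactin_PiE) auto
  then have "compact S" by (simp add: euclidean_product_topology)
  interpret function_ring_on "\<Union>n. tensor_polys n D" S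
  proof
    show "compact S" by fact
  next
    fix f g assume "f \<in> (\<Union>n. tensor_polys n D)" "g \<in> (\<Union>n. tensor_polys n D)"
    then obtain n m where fg: "f \<in> tensor_polys n D" "g \<in> tensor_polys m D" by auto
    then have "f \<in> tensor_polys (max n m) D" "g \<in> tensor_polys (max n m) D"
      using tensor_poly_mono[OF D] by (meson max.cobounded1 max.cobounded2 subsetD)+
    then show "(\<lambda>x. f x + g x) \<in> (\<Union>n. tensor_polys n D)" using tensor_poly_add by blast
    show "(\<lambda>x. f x * g x) \<in> (\<Union>n. tensor_polys n D)" using tensor_poly_mult[OF D fg] by blast
  next
    fix x y assume xy: "x \<in> S" "y \<in> S" "x \<noteq> y"
    then obtain i where "x i \<noteq> y i" by blast
    moreover have "x i \<in> (if i \<in> D then {-R..R} else {undefined})" "y i \<in> (if i \<in> D then {-R..R} else {undefined})"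
      using xy(1,2) unfolding S_def by blast+
    ultimately have "i \<in> D" by (auto split: if_splits)
    with \<open>x i \<noteq> y i\<close> show "\<exists>f\<in>\<Union>n. tensor_polys n D. f x \<noteq> f y"
      using tensor_poly_coordinate[OF D] by (intro bexI[of _ "\<lambda>x. x i"]) auto
  next
    fix f assume "f \<in> (\<Union>n. tensor_polys n D)"
    then show "continuous_on S f" by (auto intro: tensor_poly_continuous)
  next
    fix c show "(\<lambda>_. c) \<in> (\<Union>n. tensor_polys n D)" by (simp add: tensor_poly_const[OF D])
  qed
  obtain n p where p: "p \<in> tensor_polys n D" "\<forall>x\<in>S. \<bar>h x - p x\<bar> < e"
    using Stone_Weierstrass_basic[OF continuous_on_subset[OF h] e] by auto
  show thesis using p(2) S by (intro that[OF p(1)]) blast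
qed

section \<open>The regularized Christoffel function of a measure with density\<close>

lemma cube_eq: "cube D z \<epsilon> = (\<Pi>\<^sub>E k\<in>D. {z k - \<epsilon> / 2..z k + \<epsilon> / 2})"
proof -
  have "\<bar>a - b\<bar> \<le> \<epsilon> / 2 \<longleftrightarrow> a \<in> {b - \<epsilon> / 2..b + \<epsilon> / 2}" for a b :: real
    unfolding atLeastAtMost_iff by linarith
  then show ?thesis by (auto simp add: cube_def set_eq_iff PiE_iff)
qed

lemma cube_measurable [measurable]: "finite D \<Longrightarrow> cube D z \<epsilon> \<in> sets (leb D)"
  unfolding cube_eq by (rule sets_PiM_I_finite) auto

lemma emeasure_cube:
  assumes "finite D" "\<epsilon> > 0"
  shows "emeasure (leb D) (cube D z \<epsilon>) = ennreal (\<epsilon> ^ card D)"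
proof -
  interpret product_sigma_finite "\<lambda>_. lborel" ..
  show ?thesis
    unfolding cube_eq using assms by (subst emeasure_PiM) (auto simp: ennreal_power prod_constant)
qed

lemma measure_cube:
  assumes "finite D" "\<epsilon> > 0"
  shows "measure (leb D) (cube D z \<epsilon>) = \<epsilon> ^ card D"
  using emeasure_cube[OF assms] assms(2) by (simp add: measure_def)

lemma cube_mono: "\<epsilon> \<le> \<delta> \<Longrightarrow> cube D w \<epsilon> \<subseteq> cube D w \<delta>"
  unfolding cube_def by (auto intro: order.trans)

lemma restrict_cube: "x \<in> cube V z \<epsilon> \<Longrightarrow> D \<subseteq> V \<Longrightarrow> restrict x D \<in> cube D (restrict z D) \<epsilon>"
  by (auto simp: cube_def)

lemma cube_in_open:
  assumes D: "finite D" and W: "openin (powertop_real D) W" "w \<in> W"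
  obtains \<delta> where "\<delta> > 0" "cube D w \<delta> \<subseteq> W"
proof -
  obtain B where B: "\<forall>i\<in>D. openin euclideanreal (B i)" "w \<in> Pi\<^sub>E D B" "Pi\<^sub>E D B \<subseteq> W"
    using W(1)[unfolded openin_product_topology_alt, rule_format, OF W(2)] by (elim exE conjE)
  have "\<exists>e>0. cball (w i) e \<subseteq> B i" if "i \<in> D" for i
  proof -
    have "open (B i)" using B(1) that by (simp only: open_openin)
    moreover have "w i \<in> B i" using B(2) that by (rule PiE_mem)
    ultimately show ?thesis by (simp add: open_contains_cball)
  qed
  with D have "\<exists>e>0. \<forall>i\<in>D. cball (w i) e \<subseteq> B i"
  proof (induction D rule: finite_induct)
    case (insert k D)
    obtain e where e: "e > 0" "\<forall>i\<in>D. cball (w i) e \<subseteq> B i" using insert.IH insert.prems by auto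
    obtain e' where e': "e' > 0" "cball (w k) e' \<subseteq> B k" using insert.prems[of k] by auto
    show ?case
      using e e' by (intro exI[of _ "min e e'"]) (auto simp: subset_iff)
  qed (auto intro: exI[of _ 1])
  then obtain e where e: "e > 0" "\<And>i. i \<in> D \<Longrightarrow> cball (w i) e \<subseteq> B i" by auto
  have "cube D w (2 * e) \<subseteq> Pi\<^sub>E D B"
  proof
    fix x assume x: "x \<in> cube D w (2 * e)"
    show "x \<in> Pi\<^sub>E D B"
    proof (rule PiE_I)
      fix i assume "i \<in> D"
      then have "x i \<in> cball (w i) e" using x by (simp add: cube_def dist_real_def abs_minus_commute)
      then show "x i \<in> B i" using e(2)[OF \<open>i \<in> D\<close>] by blast
    next
      fix i assume "i \<notin> D"
      then show "x i = undefined" using x by (simp add: cube_def PiE_iff extensional_def)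
    qed
  qed
  then show thesis using B(3) e(1) by (intro that[of "2 * e"]) auto
qed

text \<open>
  The nearest-point retraction onto the cube. Composing with it extends a function that is continuous
  only near the cube to a continuous function on the whole space.
\<close>
definition cube_retract :: "'i set \<Rightarrow> ('i \<Rightarrow> real) \<Rightarrow> real \<Rightarrow> ('i \<Rightarrow> real) \<Rightarrow> ('i \<Rightarrow> real)" where
  "cube_retract D z \<epsilon> x = (\<lambda>k\<in>D. max (z k - \<epsilon> / 2) (min (z k + \<epsilon> / 2) (x k)))"

lemma cube_retract_in_cube: "\<epsilon> > 0 \<Longrightarrow> cube_retract D z \<epsilon> x \<in> cube D z \<epsilon>"
  by (simp add: cube_eq cube_retract_def)

lemma cube_retract_id:
  assumes x: "x \<in> cube D z \<epsilon>" shows "cube_retract D z \<epsilon> x = x"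
proof (rule ext)
  fix k
  show "cube_retract D z \<epsilon> x k = x k"
    using x by (cases "k \<in> D") (simp_all add: cube_eq cube_retract_def PiE_iff extensional_def)
qed

lemma continuous_cube_retract:
  "continuous_map euclidean (powertop_real D) (cube_retract D z \<epsilon>)"
  unfolding continuous_map_componentwise
  by (auto simp: cube_retract_def intro!: continuous_intros continuous_on_product_then_coordinatewise[OF continuous_on_id])

text \<open>
  A probability density \<open>g\<close> on \<open>\<real>\<^sup>D\<close> that vanishes outside the box \<open>[-R, R]\<^bsup>D\<^esup>\<close>. Continuity is
  asked relative to a set \<open>U\<close> around the cube, in the applications the interior of the support.
\<close>
locale christoffel =
  fixes D :: "'i::countable set" and g :: "('i \<Rightarrow> real) \<Rightarrow> real" and z :: "'i \<Rightarrow> real"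
    and \<epsilon> R :: real and U :: "('i \<Rightarrow> real) set"
  assumes finD: "finite D"
    and g_measurable [measurable]: "g \<in> borel_measurable (leb D)"
    and g_nonneg: "\<And>x. x \<in> D \<rightarrow>\<^sub>E UNIV \<Longrightarrow> g x \<ge> 0"
    and g_prob: "prob_space (density (leb D) g)"
    and g_support: "\<And>x k. x \<in> D \<rightarrow>\<^sub>E UNIV \<Longrightarrow> g x \<noteq> 0 \<Longrightarrow> k \<in> D \<Longrightarrow> \<bar>x k\<bar> \<le> R"
    and \<epsilon>_pos: "\<epsilon> > 0"
    and cube_sub: "cube D z \<epsilon> \<subseteq> U"
    and g_cont: "continuous_map (subtopology (powertop_real D) U) euclideanreal g"
    and g_pos: "\<And>x. x \<in> cube D z \<epsilon> \<Longrightarrow> g x > 0"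
begin

abbreviation "Q \<equiv> cube D z \<epsilon>"
abbreviation "\<nu> \<equiv> density (leb D) g"

definition N :: real where
  "N = (LINT y:Q|leb D. inverse (g y)) / \<epsilon> ^ (2 * card D)"

text \<open>
  The Riesz representer of the averaging functional \<open>avg\<close> in \<open>L\<^sup>2(\<nu>)\<close>; its squared norm is \<open>N\<close>.
\<close>
definition h :: "('i \<Rightarrow> real) \<Rightarrow> real" where
  "h x = indicator Q x * inverse (\<epsilon> ^ card D * g x)"

definition avg :: "(('i \<Rightarrow> real) \<Rightarrow> real) \<Rightarrow> real" where
  "avg p = (LINT y:Q|leb D. p y / \<epsilon> ^ card D)"

sublocale \<nu>: prob_space \<nu> by (rule g_prob)

lemma Q_meas [measurable]: "Q \<in> sets (leb D)" by (rule cube_measurable[OF finD])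

lemma continuous_g_cube_retract: "continuous_on S (\<lambda>x. g (cube_retract D z \<epsilon> x))"
proof -
  have "continuous_map euclidean (subtopology (powertop_real D) U) (cube_retract D z \<epsilon>)"
    using continuous_cube_retract[of D z \<epsilon>] cube_retract_in_cube[OF \<epsilon>_pos, of D z] cube_sub
    by (auto simp: continuous_map_in_subtopology)
  from continuous_map_compose[OF this g_cont] have "continuous_on UNIV (\<lambda>x. g (cube_retract D z \<epsilon> x))"
    by (simp add: comp_def)
  then show ?thesis by (rule continuous_on_subset) simp
qed

lemma g_lower: obtains c where "c > 0" "\<And>x. x \<in> Q \<Longrightarrow> c \<le> g x"
proof -
  have eq: "Q = (\<Pi>\<^sub>E k\<in>UNIV. if k \<in> D then {z k - \<epsilon> / 2..z k + \<epsilon> / 2} else {undefined})"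
    unfolding cube_eq by (auto simp: PiE_iff extensional_def) (metis atLeastAtMost_iff singletonD)+
  have "compactin (product_topology (\<lambda>_. euclidean) UNIV) Q"
    unfolding eq by (subst compactin_PiE) auto
  then have "compact Q" by (simp add: euclidean_product_topology)
  moreover have "Q \<noteq> {}" using cube_retract_in_cube[OF \<epsilon>_pos] by blast
  ultimately have "\<exists>y\<in>Q. \<forall>x\<in>Q. g (cube_retract D z \<epsilon> y) \<le> g (cube_retract D z \<epsilon> x)"
    by (rule continuous_attains_inf[OF _ _ continuous_g_cube_retract])
  then obtain y where y: "y \<in> Q" "\<And>x. x \<in> Q \<Longrightarrow> g (cube_retract D z \<epsilon> y) \<le> g (cube_retract D z \<epsilon> x)"
    by auto
  show thesis
  proof (rule that)
    show "g y > 0" by (rule g_pos[OF y(1)])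
    show "g y \<le> g x" if "x \<in> Q" for x using y(2)[OF that] y(1) that by (simp add: cube_retract_id)
  qed
qed

lemma AE_box: "AE x in \<nu>. x \<in> D \<rightarrow>\<^sub>E UNIV \<and> (\<forall>k\<in>D. \<bar>x k\<bar> \<le> R)"
proof (subst AE_density)
  show "AE x in leb D. 0 < ennreal (g x) \<longrightarrow> x \<in> D \<rightarrow>\<^sub>E UNIV \<and> (\<forall>k\<in>D. \<bar>x k\<bar> \<le> R)"
    using g_support by (intro AE_I2) (auto simp: space_PiM)
qed measurable

lemma integrable_\<nu>:
  assumes [measurable]: "f \<in> borel_measurable (leb D)"
    and "\<And>x. x \<in> D \<rightarrow>\<^sub>E UNIV \<Longrightarrow> (\<And>k. k \<in> D \<Longrightarrow> \<bar>x k\<bar> \<le> R) \<Longrightarrow> \<bar>f x\<bar> \<le> B"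
  shows "integrable \<nu> (f :: _ \<Rightarrow> real)"
proof (rule \<nu>.integrable_const_bound)
  show "AE x in \<nu>. norm (f x) \<le> B" using AE_box by eventually_elim (use assms(2) in auto)
qed measurable

lemma h_measurable [measurable]: "h \<in> borel_measurable (leb D)"
  unfolding h_def by measurable

lemma h_bounded: obtains M where "M > 0" "\<And>x. \<bar>h x\<bar> \<le> M" "\<And>x. x \<in> Q \<Longrightarrow> inverse (\<epsilon> ^ card D * g x) \<le> M"
proof -
  obtain c where c: "c > 0" "\<And>x. x \<in> Q \<Longrightarrow> c \<le> g x" by (rule g_lower) blast
  have *: "inverse (\<epsilon> ^ card D * g x) \<le> inverse (\<epsilon> ^ card D * c)" if "x \<in> Q" for x
    using c that \<epsilon>_pos by (intro le_imp_inverse_le mult_left_mono) auto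
  have "\<bar>h x\<bar> \<le> inverse (\<epsilon> ^ card D * c)" for x
    using *[of x] g_pos[of x] \<epsilon>_pos c(1) by (auto simp: h_def indicator_def)
  then show thesis using * c(1) \<epsilon>_pos by (intro that[of "inverse (\<epsilon> ^ card D * c)"]) auto
qed

lemma integral_mult_h:
  assumes [measurable]: "p \<in> borel_measurable (leb D)"
  shows "(LINT x|\<nu>. p x * h x) = avg p"
proof -
  have "(LINT x|\<nu>. p x * h x) = (LINT x|leb D. g x *\<^sub>R (p x * h x))"
    by (rule integral_density) (use g_nonneg in \<open>auto simp: space_PiM\<close>)
  also have "\<dots> = avg p"
    unfolding avg_def set_lebesgue_integral_def
    using g_pos[THEN less_imp_neq, symmetric] \<epsilon>_pos
    by (intro Bochner_Integration.integral_cong) (auto simp: h_def indicator_def field_simps)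
  finally show ?thesis .
qed

lemma integral_h_square: "(LINT x|\<nu>. h x * h x) = N"
proof -
  have "avg h = (LINT y:Q|leb D. inverse (g y) / \<epsilon> ^ (2 * card D))"
    unfolding avg_def set_lebesgue_integral_def
    by (intro Bochner_Integration.integral_cong)
       (auto simp: h_def indicator_def field_simps power_mult power2_eq_square power_mult_distrib)
  then show ?thesis using integral_mult_h[OF h_measurable] by (simp add: N_def)
qed

lemma avg_const: "avg (\<lambda>_. 1) = 1"
  using measure_cube[OF finD \<epsilon>_pos, of z] emeasure_cube[OF finD \<epsilon>_pos, of z] \<epsilon>_pos
  by (simp add: avg_def set_lebesgue_integral_def)

text \<open>
  The squared \<open>L\<^sup>2(\<nu>)\<close> distance of \<open>p\<close> from \<open>t h\<close>, which yields the Cauchy--Schwarz bound on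
  feasible polynomials and, for \<open>p = 1\<close>, also \<open>N > 0\<close>.
\<close>
lemma quadratic_nonneg:
  assumes p: "p \<in> tensor_polys n D"
  shows "0 \<le> (LINT x|\<nu>. (p x)\<^sup>2) - 2 * t * avg p + t\<^sup>2 * N"
proof -
  obtain M where M: "\<And>x. \<bar>h x\<bar> \<le> M" by (rule h_bounded) blast
  obtain K where K: "\<And>x. (\<And>k. k \<in> D \<Longrightarrow> \<bar>x k\<bar> \<le> R) \<Longrightarrow> \<bar>p x\<bar> \<le> K"
    using tensor_poly_bounded[OF finD p] by blast
  note [measurable] = tensor_poly_measurable[OF p]
  have i1: "integrable \<nu> (\<lambda>x. (p x)\<^sup>2)"
  proof (rule integrable_\<nu>[where B="K\<^sup>2"])
    fix x assume "\<And>k. k \<in> D \<Longrightarrow> \<bar>x k\<bar> \<le> R"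
    then have "\<bar>p x\<bar> \<le> K" by (rule K)
    then have "\<bar>p x\<bar>\<^sup>2 \<le> K\<^sup>2" by (rule power_mono) simp
    then show "\<bar>(p x)\<^sup>2\<bar> \<le> K\<^sup>2" by simp
  qed measurable
  have i2: "integrable \<nu> (\<lambda>x. p x * h x)"
  proof (rule integrable_\<nu>[where B="K * M"])
    fix x assume "\<And>k. k \<in> D \<Longrightarrow> \<bar>x k\<bar> \<le> R"
    then have "\<bar>p x\<bar> \<le> K" by (rule K)
    then show "\<bar>p x * h x\<bar> \<le> K * M" unfolding abs_mult by (intro mult_mono M) auto
  qed measurable
  have i3: "integrable \<nu> (\<lambda>x. h x * h x)"
  proof (rule integrable_\<nu>[where B="M * M"])
    show "\<bar>h x * h x\<bar> \<le> M * M" for x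
      unfolding abs_mult by (intro mult_mono M order.trans[OF abs_ge_zero M]) auto
  qed measurable
  have "0 \<le> (LINT x|\<nu>. (p x - t * h x)\<^sup>2)" by simp
  also have "\<dots> = (LINT x|\<nu>. (p x)\<^sup>2 - 2 * t * (p x * h x) + t\<^sup>2 * (h x * h x))"
    by (intro Bochner_Integration.integral_cong) (auto simp: power2_eq_square algebra_simps)
  also have "\<dots> = (LINT x|\<nu>. (p x)\<^sup>2) - 2 * t * avg p + t\<^sup>2 * N"
    using i1 i2 i3 by (simp add: integral_mult_h integral_h_square)
  finally show ?thesis .
qed

lemma N_pos: "N > 0"
  using quadratic_nonneg[OF tensor_poly_const[OF finD, of 1], of 1] by (simp add: avg_const \<nu>.prob_space[simplified])

lemma feasible_lower:
  assumes p: "p \<in> tensor_polys n D" "avg p = 1"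
  shows "inverse N \<le> (LINT x|\<nu>. (p x)\<^sup>2)"
proof -
  have "(inverse N)\<^sup>2 * N = inverse N" using N_pos by (simp add: power2_eq_square)
  then show ?thesis using quadratic_nonneg[OF p(1), of "inverse N"] p(2) by simp
qed

text \<open>
  Continuous cutoffs that equal 1 on the cube and decrease pointwise to its indicator.
\<close>
definition tent :: "nat \<Rightarrow> ('i \<Rightarrow> real) \<Rightarrow> real" where
  "tent j x = (\<Prod>k\<in>D. max 0 (1 - real j * \<bar>x k - cube_retract D z \<epsilon> x k\<bar>))"

lemma tent_bounds: "0 \<le> tent j x" "tent j x \<le> 1"
  unfolding tent_def by (auto intro!: prod_nonneg prod_le_1)

lemma tent_tendsto:
  assumes x: "x \<in> D \<rightarrow>\<^sub>E UNIV"
  shows "(\<lambda>j. tent j x * inverse (\<epsilon> ^ card D * g (cube_retract D z \<epsilon> x))) \<longlonglongrightarrow> h x"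
proof (cases "x \<in> Q")
  case True
  then show ?thesis by (simp add: tent_def h_def cube_retract_id)
next
  case False
  have in_Q: "cube_retract D z \<epsilon> x \<in> Q" by (rule cube_retract_in_cube[OF \<epsilon>_pos])
  then have "cube_retract D z \<epsilon> x \<noteq> x" using False by auto
  moreover have "cube_retract D z \<epsilon> x \<in> D \<rightarrow>\<^sub>E UNIV" using in_Q by (simp add: cube_def)
  ultimately obtain k where k: "k \<in> D" "x k \<noteq> cube_retract D z \<epsilon> x k"
    using PiE_ext[OF x, of "cube_retract D z \<epsilon> x"] by metis
  define \<delta> where "\<delta> = \<bar>x k - cube_retract D z \<epsilon> x k\<bar>"
  have "\<delta> > 0" using k by (simp add: \<delta>_def)
  obtain m where m: "real m > 1 / \<delta>" using reals_Archimedean2 by blast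
  have "tent j x = 0" if "j \<ge> m" for j
  proof -
    have "1 / \<delta> \<le> real j" using m that by linarith
    then have "1 - real j * \<delta> \<le> 0" using \<open>\<delta> > 0\<close> by (simp add: field_simps)
    then show ?thesis unfolding tent_def \<delta>_def using k(1) finD by (intro prod_zero bexI[of _ k]) (simp_all add: max_absorb1)
  qed
  then have "(\<lambda>j. tent j x * inverse (\<epsilon> ^ card D * g (cube_retract D z \<epsilon> x))) \<longlonglongrightarrow> 0"
    by (intro tendsto_eventually) (auto simp: eventually_at_top_linorder intro!: exI[of _ m])
  then show ?thesis using False by (simp add: h_def)
qed

lemma continuous_tent: "continuous_on S (\<lambda>x. tent j x * inverse (\<epsilon> ^ card D * g (cube_retract D z \<epsilon> x)))"
proof -
  have "continuous_on S (\<lambda>x. cube_retract D z \<epsilon> x k)" if "k \<in> D" for k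
    unfolding cube_retract_def using that
    by (auto intro!: continuous_intros continuous_on_product_then_coordinatewise[OF continuous_on_id])
  moreover have "g (cube_retract D z \<epsilon> x) \<noteq> 0" for x using g_pos[OF cube_retract_in_cube[OF \<epsilon>_pos, of D z x]] by simp
  ultimately show ?thesis
    unfolding tent_def using \<epsilon>_pos
    by (intro continuous_intros continuous_g_cube_retract continuous_on_max continuous_on_product_then_coordinatewise[OF continuous_on_id]) auto
qed

text \<open>
  Polynomials that approximate \<open>h\<close> in \<open>L\<^sup>2(\<nu>)\<close>. The \<open>j\<close>-th one is within \<open>1 / (j + 1)\<close>, on
  the box, of the continuous function that is \<open>tent j\<close> times the extension of \<open>h\<close>. Hence the
  sequence converges pointwise to \<open>h\<close> and is uniformly bounded on the support of \<open>\<nu>\<close>, and dominated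
  convergence applies.
\<close>
lemma poly_approximation:
  obtains q :: "nat \<Rightarrow> ('i \<Rightarrow> real) \<Rightarrow> real" and n :: "nat \<Rightarrow> nat" where
    "\<And>j. q j \<in> tensor_polys (n j) D"
    "(\<lambda>j. LINT x|\<nu>. (q j x)\<^sup>2) \<longlonglongrightarrow> N" "(\<lambda>j. avg (q j)) \<longlonglongrightarrow> N"
proof -
  obtain M where M: "M > 0" "\<And>x. \<bar>h x\<bar> \<le> M" "\<And>x. x \<in> Q \<Longrightarrow> inverse (\<epsilon> ^ card D * g x) \<le> M"
    by (rule h_bounded) blast
  define t where "t j x = tent j x * inverse (\<epsilon> ^ card D * g (cube_retract D z \<epsilon> x))" for j x
  have "\<exists>n q. q \<in> tensor_polys n D \<and> (\<forall>x\<in>D \<rightarrow>\<^sub>E UNIV. (\<forall>k\<in>D. \<bar>x k\<bar> \<le> R) \<longrightarrow> \<bar>t j x - q x\<bar> < inverse (Suc j))" for j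
  proof -
    have "inverse (real (Suc j)) > 0" by simp
    then obtain n q where "q \<in> tensor_polys n D"
      "\<And>x. x \<in> D \<rightarrow>\<^sub>E UNIV \<Longrightarrow> (\<And>k. k \<in> D \<Longrightarrow> \<bar>x k\<bar> \<le> R) \<Longrightarrow> \<bar>t j x - q x\<bar> < inverse (real (Suc j))"
      unfolding t_def by (rule tensor_poly_dense[OF finD continuous_tent]) blast
    then show ?thesis by (intro exI[of _ n] exI[of _ q]) auto
  qed
  then obtain n q where q: "\<And>j. q j \<in> tensor_polys (n j) D"
    "\<And>j x. x \<in> D \<rightarrow>\<^sub>E UNIV \<Longrightarrow> (\<forall>k\<in>D. \<bar>x k\<bar> \<le> R) \<Longrightarrow> \<bar>t j x - q j x\<bar> < inverse (Suc j)"
    by metis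
  note [measurable] = tensor_poly_measurable[OF q(1)]
  have lim: "(\<lambda>j. q j x) \<longlonglongrightarrow> h x" if "x \<in> D \<rightarrow>\<^sub>E UNIV" "\<forall>k\<in>D. \<bar>x k\<bar> \<le> R" for x
  proof -
    have "(\<lambda>j. t j x - q j x) \<longlonglongrightarrow> 0"
      by (rule Lim_null_comparison[OF _ LIMSEQ_inverse_real_of_nat])
         (use q(2)[OF that] in \<open>auto intro!: always_eventually less_imp_le\<close>)
    from tendsto_diff[OF tent_tendsto[OF that(1), folded t_def] this] show ?thesis by simp
  qed
  \<comment> \<open>The same constant bounds the extension, since the retraction takes values in the cube.\<close>
  have tM: "\<bar>t j x\<bar> \<le> M" for j x
  proof -
    have "\<bar>t j x\<bar> \<le> 1 * M"
      unfolding t_def abs_mult using M(1,3) tent_bounds[of j x] cube_retract_in_cube[OF \<epsilon>_pos, of D z x] g_pos \<epsilon>_pos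
      by (intro mult_mono) (auto simp: abs_mult less_imp_le)
    then show ?thesis by simp
  qed
  have bound: "\<bar>q j x\<bar> \<le> M + 1" if "x \<in> D \<rightarrow>\<^sub>E UNIV" "\<forall>k\<in>D. \<bar>x k\<bar> \<le> R" for j x
  proof -
    have "inverse (real (Suc j)) \<le> 1" by (simp add: field_simps)
    then show ?thesis using q(2)[OF that, of j] tM[of j x] by linarith
  qed
  have sq: "(\<lambda>j. LINT x|\<nu>. (q j x)\<^sup>2) \<longlonglongrightarrow> (LINT x|\<nu>. h x * h x)"
  proof (rule integral_dominated_convergence[where w="\<lambda>_. (M + 1)\<^sup>2"])
    show "AE x in \<nu>. (\<lambda>j. (q j x)\<^sup>2) \<longlonglongrightarrow> h x * h x"
      using AE_box by eventually_elim (use lim in \<open>auto simp: power2_eq_square intro!: tendsto_mult\<close>)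
    show "AE x in \<nu>. norm ((q j x)\<^sup>2) \<le> (M + 1)\<^sup>2" for j
      using AE_box
    proof eventually_elim
      case (elim x)
      then have "\<bar>q j x\<bar>\<^sup>2 \<le> (M + 1)\<^sup>2" using bound[of x j] by (intro power_mono) auto
      then show ?case by simp
    qed
  qed auto
  have lin: "(\<lambda>j. LINT x|\<nu>. q j x * h x) \<longlonglongrightarrow> (LINT x|\<nu>. h x * h x)"
  proof (rule integral_dominated_convergence[where w="\<lambda>_. (M + 1) * M"])
    show "AE x in \<nu>. (\<lambda>j. q j x * h x) \<longlonglongrightarrow> h x * h x"
      using AE_box by eventually_elim (use lim in \<open>auto intro!: tendsto_mult\<close>)
    show "AE x in \<nu>. norm (q j x * h x) \<le> (M + 1) * M" for j
      using AE_box
    proof eventually_elim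
      case (elim x)
      then show ?case using bound[of x j] M(1,2) unfolding real_norm_def abs_mult by (intro mult_mono) auto
    qed
  qed auto
  show thesis
    using that[OF q(1)] sq lin by (simp add: integral_mult_h integral_h_square)
qed

text \<open>
  The minima are bounded below by \<open>1 / N\<close>. Normalizing the approximants of \<open>h\<close> to average 1 gives
  feasible polynomials whose squared norms tend to \<open>N / N\<^sup>2 = 1 / N\<close>.
\<close>
theorem reg_christoffel_tendsto:
  assumes "D \<noteq> {}"
  shows "(\<lambda>n. reg_christoffel D \<nu> n z \<epsilon>) \<longlonglongrightarrow> N"
proof -
  define F where "F n = {LINT x|\<nu>. (p x)\<^sup>2 | p. p \<in> tensor_polys n D \<and> avg p = 1}" for n
  obtain q m where q: "\<And>j. q j \<in> tensor_polys (m j) D"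
    "(\<lambda>j. LINT x|\<nu>. (q j x)\<^sup>2) \<longlonglongrightarrow> N" "(\<lambda>j. avg (q j)) \<longlonglongrightarrow> N"
    by (rule poly_approximation) blast
  have bdd: "bdd_below (F n)" for n
    by (rule bdd_belowI[of _ "inverse N"]) (auto simp: F_def feasible_lower)
  have ne: "F n \<noteq> {}" for n
    using tensor_poly_const[OF finD, of 1 n] avg_const by (auto simp: F_def)
  have lower: "inverse N \<le> Inf (F n)" for n
    by (rule cInf_greatest[OF ne]) (auto simp: F_def feasible_lower)
  have "(\<lambda>n. Inf (F n)) \<longlonglongrightarrow> inverse N"
  proof (rule LIMSEQ_I)
    fix r :: real assume "r > 0"
    have "(\<lambda>j. (LINT x|\<nu>. (q j x)\<^sup>2) / (avg (q j))\<^sup>2) \<longlonglongrightarrow> N / N\<^sup>2"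
      using q N_pos by (intro tendsto_intros) auto
    also have "N / N\<^sup>2 = inverse N" using N_pos by (simp add: power2_eq_square field_simps)
    finally have "\<forall>\<^sub>F j in sequentially. (LINT x|\<nu>. (q j x)\<^sup>2) / (avg (q j))\<^sup>2 < inverse N + r"
      by (rule order_tendstoD) (use \<open>r > 0\<close> in simp)
    moreover have "\<forall>\<^sub>F j in sequentially. avg (q j) > 0" using q(3) N_pos by (rule order_tendstoD)
    ultimately have "\<forall>\<^sub>F j in sequentially. (LINT x|\<nu>. (q j x)\<^sup>2) / (avg (q j))\<^sup>2 < inverse N + r \<and> avg (q j) > 0"
      by eventually_elim simp
    from eventually_happens'[OF sequentially_bot this]
    obtain j where j: "(LINT x|\<nu>. (q j x)\<^sup>2) / (avg (q j))\<^sup>2 < inverse N + r" "avg (q j) > 0"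
      by (elim exE conjE)
    define p where "p = (\<lambda>x. inverse (avg (q j)) * q j x)"
    have p: "p \<in> tensor_polys (m j) D" unfolding p_def by (rule tensor_poly_scale[OF q(1)])
    have "avg p = inverse (avg (q j)) * avg (q j)"
      unfolding p_def avg_def by (subst set_integral_mult_right[symmetric]) simp
    then have "avg p = 1" using j by simp
    have int_p: "(LINT x|\<nu>. (p x)\<^sup>2) = (LINT x|\<nu>. (q j x)\<^sup>2) / (avg (q j))\<^sup>2"
      by (simp add: p_def power_mult_distrib field_simps)
    have upper: "Inf (F n) < inverse N + r" if "n \<ge> m j" for n
    proof -
      have "p \<in> tensor_polys n D" using p tensor_poly_mono[OF finD that] by blast
      then have "(LINT x|\<nu>. (p x)\<^sup>2) \<in> F n"
        using \<open>avg p = 1\<close> unfolding F_def by blast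
      from cInf_lower[OF this bdd] j(1) show ?thesis unfolding int_p by linarith
    qed
    show "\<exists>n0. \<forall>n\<ge>n0. norm (Inf (F n) - inverse N) < r"
    proof (intro exI[of _ "m j"] allI impI)
      fix n assume "m j \<le> n"
      from upper[OF this] lower[of n] show "norm (Inf (F n) - inverse N) < r" by simp
    qed
  qed
  from tendsto_inverse[OF this] show ?thesis
    using assms N_pos by (simp add: reg_christoffel_def F_def avg_def)
qed

text \<open>
  The number \<open>\<epsilon>\<^bsup>|D|\<^esup> N\<close> is the mean of \<open>1 / g\<close> over the cube, so it lies between
  \<open>1 / (G + \<eta>)\<close> and \<open>1 / (G - \<eta>)\<close>.
\<close>
lemma avg_inverse_bounds:
  assumes G: "\<And>y. y \<in> Q \<Longrightarrow> \<bar>g y - G\<bar> \<le> \<eta>" and \<eta>: "\<eta> < G"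
  shows "\<bar>inverse (\<epsilon> ^ card D * N) - G\<bar> \<le> \<eta>"
proof -
  define k where "k = card D"
  have pos: "\<epsilon> ^ k > 0" using \<epsilon>_pos by simp
  have \<eta>0: "\<eta> \<ge> 0" using G[OF cube_retract_in_cube[OF \<epsilon>_pos, of D z z]] by linarith
  define I where "I = (LINT y:Q|leb D. inverse (g y))"
  have lo: "inverse (G + \<eta>) \<le> inverse (g y)" and up: "inverse (g y) \<le> inverse (G - \<eta>)" if "y \<in> Q" for y
    using G[OF that] g_pos[OF that] \<eta> by (intro le_imp_inverse_le; linarith)+
  have fin: "emeasure (leb D) Q < \<infinity>" by (simp add: emeasure_cube[OF finD \<epsilon>_pos])
  have ic: "set_integrable (leb D) Q (\<lambda>_. c)" for c :: real
    using fin unfolding set_integrable_def by simp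
  have ig: "set_integrable (leb D) Q (\<lambda>y. inverse (g y))"
    unfolding set_integrable_def
  proof (rule Bochner_Integration.integrable_bound[OF ic[of "inverse (G - \<eta>)", unfolded set_integrable_def]])
    show "AE x in leb D. norm (indicat_real Q x *\<^sub>R inverse (g x)) \<le> norm (indicat_real Q x *\<^sub>R inverse (G - \<eta>))"
      using up \<eta> g_pos by (intro AE_I2) (auto simp: indicator_def less_imp_le abs_of_pos)
  qed measurable
  have const: "(LINT y:Q|leb D. c) = c * \<epsilon> ^ k" for c :: real
    using measure_cube[OF finD \<epsilon>_pos, of z] fin
    by (simp add: set_lebesgue_integral_def k_def)
  have "inverse (G + \<eta>) * \<epsilon> ^ k \<le> I"
    unfolding I_def const[symmetric] by (rule set_integral_mono[OF ic ig lo])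
  moreover have "I \<le> inverse (G - \<eta>) * \<epsilon> ^ k"
    unfolding I_def const[symmetric] by (rule set_integral_mono[OF ig ic up])
  moreover have "\<epsilon> ^ card D * N = I / \<epsilon> ^ k"
    using pos by (simp add: N_def I_def k_def power_mult power2_eq_square mult_2 power_add)
  ultimately have b: "inverse (G + \<eta>) \<le> \<epsilon> ^ card D * N" "\<epsilon> ^ card D * N \<le> inverse (G - \<eta>)"
    using pos by (simp_all add: pos_le_divide_eq pos_divide_le_eq)
  have "inverse (\<epsilon> ^ card D * N) \<le> G + \<eta>"
    using le_imp_inverse_le[OF b(1)] \<eta> \<eta>0 by simp
  moreover have "G - \<eta> \<le> inverse (\<epsilon> ^ card D * N)"
    using le_imp_inverse_le[OF b(2)] N_pos \<epsilon>_pos by simp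
  ultimately show ?thesis by linarith
qed

end

section \<open>Marginal densities\<close>

context
  fixes V D :: "'i set" and f :: "('i \<Rightarrow> real) \<Rightarrow> real"
  assumes V: "finite V" and D: "D \<subseteq> V" "D \<noteq> {}"
    and f [measurable]: "f \<in> borel_measurable (leb V)"
    and nonneg: "\<And>x. x \<in> V \<rightarrow>\<^sub>E UNIV \<Longrightarrow> f x \<ge> 0"
begin

lemma merge_measurable [measurable]:
  "(\<lambda>p. f (merge D (V - D) p)) \<in> borel_measurable (leb D \<Otimes>\<^sub>M leb (V - D))"
proof -
  have "D \<union> (V - D) = V" using D by auto
  then have "merge D (V - D) \<in> leb D \<Otimes>\<^sub>M leb (V - D) \<rightarrow>\<^sub>M leb V"
    using measurable_merge[of D "V - D" "\<lambda>_. lborel"] by (simp only:)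
  then show ?thesis by (rule measurable_compose[OF _ f])
qed

lemma merge_space: "x \<in> space (leb D) \<Longrightarrow> y \<in> space (leb (V - D)) \<Longrightarrow> merge D (V - D) (x, y) \<in> V \<rightarrow>\<^sub>E UNIV"
  using D by (auto simp: space_PiM merge_def PiE_iff extensional_def)

lemma marginal_density_measurable: "marginal_density V f D \<in> borel_measurable (leb D)"
proof -
  interpret product_sigma_finite "\<lambda>_. lborel" ..
  interpret VD: sigma_finite_measure "leb (V - D)" by (rule sigma_finite) (use V in auto)
  have "(\<lambda>x. LINT y|leb (V - D). f (merge D (V - D) (x, y))) \<in> borel_measurable (leb D)"
    by measurable
  moreover have "marginal_density V f D = (\<lambda>x. LINT y|leb (V - D). f (merge D (V - D) (x, y)))"
    using D(2) by (simp add: marginal_density_def fun_eq_iff)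
  ultimately show ?thesis by simp
qed

lemma marginal_density_nonneg: "x \<in> D \<rightarrow>\<^sub>E UNIV \<Longrightarrow> marginal_density V f D x \<ge> 0"
  using D(2) by (auto simp: marginal_density_def space_PiM intro!: Bochner_Integration.integral_nonneg nonneg merge_space)

text \<open>
  Tonelli's theorem. The real-valued integral that defines \<open>marginal_density\<close> is 0 on the null set
  where the fibre integral \<open>F\<close> is infinite; finiteness of the total mass is what makes this set null.
\<close>
lemma marginal_eq_density:
  assumes fin: "(\<integral>\<^sup>+x. f x \<partial>leb V) < \<infinity>"
  shows "marginal D (density (leb V) f) = density (leb D) (marginal_density V f D)"
proof (rule measure_eqI)
  show "sets (marginal D (density (leb V) f)) = sets (density (leb D) (marginal_density V f D))"
    by (simp add: marginal_def)
next
  fix B assume "B \<in> sets (marginal D (density (leb V) f))"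
  then have B [measurable]: "B \<in> sets (leb D)" by (simp add: marginal_def)
  interpret product_sigma_finite "\<lambda>_. lborel" ..
  interpret VD: sigma_finite_measure "leb (V - D)" by (rule sigma_finite) (use V in auto)
  note [measurable] = marginal_density_measurable
  have DV: "D \<union> (V - D) = V" using D by auto
  have fD: "finite D" using finite_subset[OF D(1) V] .
  have R [measurable]: "(\<lambda>x. restrict x D) \<in> leb V \<rightarrow>\<^sub>M leb D" by (rule measurable_restrict_subset[OF D(1)])
  define F where "F x = (\<integral>\<^sup>+y. f (merge D (V - D) (x, y)) \<partial>leb (V - D))" for x
  have F [measurable]: "F \<in> borel_measurable (leb D)" unfolding F_def by measurable
  have fold: "(\<integral>\<^sup>+x. ennreal (f x) * indicator C (restrict x D) \<partial>leb V) = (\<integral>\<^sup>+x. F x * indicator C x \<partial>leb D)"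
    if [measurable]: "C \<in> sets (leb D)" for C
  proof -
    have "(\<integral>\<^sup>+x. ennreal (f x) * indicator C (restrict x D) \<partial>leb V) =
      (\<integral>\<^sup>+x. (\<integral>\<^sup>+y. ennreal (f (merge D (V - D) (x, y))) * indicator C (restrict (merge D (V - D) (x, y)) D) \<partial>leb (V - D)) \<partial>leb D)"
      using product_nn_integral_fold[of D "V - D" "\<lambda>x. ennreal (f x) * indicator C (restrict x D)"] fD V
      unfolding DV by simp
    also have "\<dots> = (\<integral>\<^sup>+x. F x * indicator C x \<partial>leb D)"
    proof (rule nn_integral_cong)
      fix x assume x: "x \<in> space (leb D)"
      have r: "restrict (merge D (V - D) (x, y)) D = x" for y
        using x by (auto simp: space_PiM merge_def PiE_iff extensional_def fun_eq_iff)
      have [measurable]: "(\<lambda>y. f (merge D (V - D) (x, y))) \<in> borel_measurable (leb (V - D))"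
        using measurable_compose[OF measurable_Pair1'[OF x] merge_measurable] .
      show "(\<integral>\<^sup>+y. ennreal (f (merge D (V - D) (x, y))) * indicator C (restrict (merge D (V - D) (x, y)) D) \<partial>leb (V - D))
        = F x * indicator C x"
        unfolding r F_def by (rule nn_integral_multc) measurable
    qed
    finally show ?thesis .
  qed
  have "(\<integral>\<^sup>+x. F x \<partial>leb D) = (\<integral>\<^sup>+x. F x * indicator (space (leb D)) x \<partial>leb D)"
    by (intro nn_integral_cong) simp
  also have "\<dots> = (\<integral>\<^sup>+x. ennreal (f x) * indicator (space (leb D)) (restrict x D) \<partial>leb V)"
    by (rule fold[symmetric]) simp
  also have "\<dots> = (\<integral>\<^sup>+x. f x \<partial>leb V)"
    by (intro nn_integral_cong) (auto simp: space_PiM indicator_def)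
  finally have "(\<integral>\<^sup>+x. F x \<partial>leb D) \<noteq> \<infinity>" using fin by simp
  then have "AE x in leb D. F x \<noteq> \<infinity>" by (intro nn_integral_noteq_infinite) auto
  then have AE: "AE x in leb D. F x = ennreal (marginal_density V f D x)"
  proof (rule AE_mp, intro AE_I2 impI)
    fix x assume x: "x \<in> space (leb D)" and "F x \<noteq> \<infinity>"
    have m [measurable]: "(\<lambda>y. f (merge D (V - D) (x, y))) \<in> borel_measurable (leb (V - D))"
      using measurable_compose[OF measurable_Pair1'[OF x] merge_measurable] .
    have nn: "AE y in leb (V - D). 0 \<le> f (merge D (V - D) (x, y))"
      using x by (intro AE_I2 nonneg merge_space)
    have "integrable (leb (V - D)) (\<lambda>y. f (merge D (V - D) (x, y)))"
      using \<open>F x \<noteq> \<infinity>\<close> nn by (intro integrableI_nonneg) (auto simp: F_def top.not_eq_extremum)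
    from nn_integral_eq_integral[OF this nn] show "F x = ennreal (marginal_density V f D x)"
      using D(2) by (simp add: F_def marginal_density_def)
  qed
  have "emeasure (marginal D (density (leb V) f)) B
      = emeasure (density (leb V) f) ((\<lambda>x. restrict x D) -` B \<inter> space (leb V))"
    unfolding marginal_def by (subst emeasure_distr) auto
  also have "\<dots> = (\<integral>\<^sup>+x. ennreal (f x) * indicator B (restrict x D) \<partial>leb V)"
    by (subst emeasure_density) (auto intro!: nn_integral_cong simp: indicator_def)
  also have "\<dots> = (\<integral>\<^sup>+x. F x * indicator B x \<partial>leb D)" by (rule fold[OF B])
  also have "\<dots> = (\<integral>\<^sup>+x. ennreal (marginal_density V f D x) * indicator B x \<partial>leb D)"
    using AE by (intro nn_integral_cong_AE) auto
  also have "\<dots> = emeasure (density (leb D) (marginal_density V f D)) B"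
    by (subst emeasure_density) auto
  finally show "emeasure (marginal D (density (leb V) f)) B = emeasure (density (leb D) (marginal_density V f D)) B" .
qed

end

lemma marginal_density_full:
  assumes "x \<in> V \<rightarrow>\<^sub>E UNIV" "V \<noteq> {}"
  shows "marginal_density V f V x = f x"
proof -
  interpret product_sigma_finite "\<lambda>_. lborel" ..
  have "merge V {} (x, y) = x" for y
    using assms(1) by (auto simp: merge_def fun_eq_iff PiE_iff extensional_def)
  then show ?thesis
    using assms(2) by (simp add: marginal_density_def PiM_empty)
qed

section \<open>Behaviour of the marginals near an interior point\<close>

text \<open>
  The analytic setting at a fixed interior point \<open>z\<close> of the support, over an arbitrary finite index
  set \<open>V\<close>.
\<close>
locale marginal_regularity =
  fixes V :: "'i::countable set" and \<mu> :: "('i \<Rightarrow> real) measure" and f :: "('i \<Rightarrow> real) \<Rightarrow> real"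
    and \<Omega> :: "('i \<Rightarrow> real) set" and z :: "'i \<Rightarrow> real"
  assumes finV: "finite V"
    and prob: "prob_space \<mu>"
    and f_measurable: "f \<in> borel_measurable (leb V)"
    and f_nonneg: "\<And>x. x \<in> V \<rightarrow>\<^sub>E UNIV \<Longrightarrow> f x \<ge> 0"
    and \<mu>_def: "\<mu> = density (leb V) (\<lambda>x. ennreal (f x))"
    and \<Omega>_compact: "compactin (powertop_real V) \<Omega>"
    and continuous: "\<And>A. A \<noteq> {} \<Longrightarrow> A \<subseteq> V \<Longrightarrow>
           continuous_map (subtopology (powertop_real A) (powertop_real A interior_of coord_proj A \<Omega>))
             euclideanreal (marginal_density V f A)"
    and positive: "\<And>A x. A \<noteq> {} \<Longrightarrow> A \<subseteq> V \<Longrightarrow> x \<in> powertop_real A interior_of coord_proj A \<Omega> \<Longrightarrow>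
           marginal_density V f A x > 0"
    and zero: "\<And>A x. A \<noteq> {} \<Longrightarrow> A \<subseteq> V \<Longrightarrow> x \<in> (A \<rightarrow>\<^sub>E UNIV) - coord_proj A \<Omega> \<Longrightarrow>
           marginal_density V f A x = 0"
    and Lipschitz: "\<And>A. A \<noteq> {} \<Longrightarrow> A \<subseteq> V \<Longrightarrow>
           locally_Lipschitz_on A (powertop_real A interior_of coord_proj A \<Omega>)
             (marginal_density V f A)"
    and z_interior: "z \<in> powertop_real V interior_of \<Omega>"
begin

definition m :: "'i set \<Rightarrow> ('i \<Rightarrow> real) \<Rightarrow> real" where
  "m A x = marginal_density V f A (restrict x A)"

lemma z_space: "z \<in> V \<rightarrow>\<^sub>E UNIV"
  using z_interior interior_of_subset_topspace[of "powertop_real V" \<Omega>] by auto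

lemma \<Omega>_bounded: obtains R where "\<And>x k. x \<in> \<Omega> \<Longrightarrow> k \<in> V \<Longrightarrow> \<bar>x k\<bar> \<le> R"
proof -
  have "bounded ((\<lambda>x. x k) ` \<Omega>)" if "k \<in> V" for k
  proof -
    have "continuous_map (powertop_real V) euclideanreal (\<lambda>x. x k)"
      using that by (rule continuous_map_product_projection)
    from image_compactin[OF \<Omega>_compact this] show ?thesis by (simp add: compact_imp_bounded)
  qed
  then have "bounded (\<Union>k\<in>V. (\<lambda>x. x k) ` \<Omega>)" using finV by (intro bounded_UN) auto
  then obtain R where "\<forall>y\<in>(\<Union>k\<in>V. (\<lambda>x. x k) ` \<Omega>). norm y \<le> R" unfolding bounded_iff by (elim exE)
  then show thesis by (intro that[of R]) auto
qed

text \<open>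
  Coordinate projections are open: a box around \<open>z\<close> inside \<open>\<Omega>\<close> projects onto a box around
  \<open>z\<^sub>A\<close>.
\<close>
lemma restrict_z_interior:
  assumes A: "A \<subseteq> V"
  shows "restrict z A \<in> powertop_real A interior_of coord_proj A \<Omega>"
proof -
  obtain \<delta> where \<delta>: "\<delta> > 0" "cube V z \<delta> \<subseteq> powertop_real V interior_of \<Omega>"
    using cube_in_open[OF finV openin_interior_of z_interior] by metis
  define B where "B = (\<Pi>\<^sub>E k\<in>A. {z k - \<delta> / 2<..<z k + \<delta> / 2})"
  have "openin (powertop_real A) B"
    unfolding B_def using finite_subset[OF A finV] by (subst openin_PiE) auto
  moreover have "B \<subseteq> coord_proj A \<Omega>"
  proof
    fix y assume y: "y \<in> B"
    define x where "x = (\<lambda>k\<in>V. if k \<in> A then y k else z k)"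
    have "x \<in> cube V z \<delta>"
      unfolding cube_eq x_def using y A \<delta>(1) by (auto simp: B_def PiE_iff less_imp_le)
    then have "x \<in> \<Omega>" using subset_trans[OF \<delta>(2) interior_of_subset] by (rule subsetD[rotated])
    moreover have "restrict x A = y"
    proof (rule ext)
      fix k show "restrict x A k = y k"
        using y A by (cases "k \<in> A") (auto simp: x_def B_def PiE_iff extensional_def)
    qed
    ultimately show "y \<in> coord_proj A \<Omega>" unfolding coord_proj_def by blast
  qed
  moreover have "restrict z A \<in> B" using \<delta>(1) by (simp add: B_def)
  ultimately show ?thesis by (meson interior_of_maximal subsetD)
qed

lemma local_Lipschitz_cube:
  assumes A: "A \<noteq> {}" "A \<subseteq> V"
  obtains \<delta> L where "\<delta> > 0" "cube A (restrict z A) \<delta> \<subseteq> powertop_real A interior_of coord_proj A \<Omega>"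
    "\<And>\<epsilon> y. \<epsilon> \<le> \<delta> \<Longrightarrow> y \<in> cube A (restrict z A) \<epsilon> \<Longrightarrow> \<bar>marginal_density V f A y - m A z\<bar> \<le> L * \<epsilon>"
proof -
  let ?z = "restrict z A"
  let ?S = "powertop_real A interior_of coord_proj A \<Omega>"
  have fA: "finite A" by (rule finite_subset[OF A(2) finV])
  have zS: "?z \<in> ?S" by (rule restrict_z_interior[OF A(2)])
  obtain U L where U: "openin (powertop_real A) U" "?z \<in> U"
    and L: "\<forall>y\<in>U \<inter> ?S. \<forall>y'\<in>U \<inter> ?S.
      \<bar>marginal_density V f A y - marginal_density V f A y'\<bar> \<le> L * L2_set (\<lambda>k. y k - y' k) A"
    using bspec[OF Lipschitz[OF A, unfolded locally_Lipschitz_on_def] zS] by (elim exE conjE)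
  have zUS: "?z \<in> U \<inter> ?S" using U(2) zS by blast
  obtain \<delta> where \<delta>: "\<delta> > 0" "cube A ?z \<delta> \<subseteq> U \<inter> ?S"
    by (rule cube_in_open[OF fA openin_Int[OF U(1) openin_interior_of] zUS])
  show thesis
  proof (rule that[OF \<delta>(1)])
    show "cube A ?z \<delta> \<subseteq> ?S" using \<delta>(2) by simp
    fix \<epsilon> y assume \<epsilon>: "\<epsilon> \<le> \<delta>" and y: "y \<in> cube A ?z \<epsilon>"
    have yU: "y \<in> U \<inter> ?S" using \<delta>(2) cube_mono[OF \<epsilon>] y by blast
    have yk: "\<bar>y k - z k\<bar> \<le> \<epsilon> / 2" if "k \<in> A" for k using y that by (simp add: cube_def)
    obtain k where "k \<in> A" using A(1) by blast
    then have \<epsilon>0: "\<epsilon> \<ge> 0" using yk[of k] abs_ge_zero[of "y k - z k"] by linarith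
    have "L2_set (\<lambda>k. y k - ?z k) A \<le> (\<Sum>k\<in>A. \<bar>y k - ?z k\<bar>)" by (rule L2_set_le_sum_abs)
    also have "\<dots> \<le> (\<Sum>k\<in>A. \<epsilon> / 2)" using yk by (intro sum_mono) simp
    also have "\<dots> \<le> card A * \<epsilon>" using \<epsilon>0 by (simp add: mult_left_mono)
    finally have "L * L2_set (\<lambda>k. y k - ?z k) A \<le> \<bar>L\<bar> * (card A * \<epsilon>)"
      by (intro mult_mono) (auto simp: L2_set_nonneg)
    moreover have "\<bar>marginal_density V f A y - marginal_density V f A ?z\<bar> \<le> L * L2_set (\<lambda>k. y k - ?z k) A"
      using L yU U(2) zS by blast
    ultimately show "\<bar>marginal_density V f A y - m A z\<bar> \<le> (\<bar>L\<bar> * card A) * \<epsilon>"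
      by (simp add: m_def mult.assoc)
  qed
qed

lemma m_pos: "A \<subseteq> V \<Longrightarrow> m A z > 0"
  using positive[of A "restrict z A"] restrict_z_interior[of A]
  by (cases "A = {}") (auto simp: m_def marginal_density_def)

text \<open>
  For small \<open>\<epsilon>\<close> the cube around \<open>z\<^sub>A\<close> lies in the interior of the projected support, where \<open>f\<^sub>A\<close>
  is positive and within \<open>L \<epsilon>\<close> of its value at the centre. For \<open>A = {}\<close> all quantities are 1 by
  convention.
\<close>
lemma christoffel_asymptotics:
  assumes A: "A \<subseteq> V"
  shows "\<exists>\<Lambda> C. \<forall>\<^sub>F \<epsilon> in at_right 0.
      (\<lambda>n. reg_christoffel A (marginal A \<mu>) n (restrict z A) \<epsilon>) \<longlonglongrightarrow> \<Lambda> \<epsilon> \<and> \<Lambda> \<epsilon> > 0 \<and>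
      \<bar>inverse (\<epsilon> ^ card A * \<Lambda> \<epsilon>) - m A z\<bar> \<le> C * \<epsilon>"
proof (cases "A = {}")
  case True
  then show ?thesis
    by (intro exI[of _ "\<lambda>_. 1"] exI[of _ 0]) (simp add: reg_christoffel_def m_def marginal_density_def)
next
  case False
  let ?g = "marginal_density V f A"
  let ?S = "powertop_real A interior_of coord_proj A \<Omega>"
  let ?z = "restrict z A"
  have fA: "finite A" by (rule finite_subset[OF A finV])
  obtain \<delta> L where \<delta>: "\<delta> > 0" "cube A ?z \<delta> \<subseteq> ?S"
    and L: "\<And>\<epsilon> y. \<epsilon> \<le> \<delta> \<Longrightarrow> y \<in> cube A ?z \<epsilon> \<Longrightarrow> \<bar>?g y - m A z\<bar> \<le> L * \<epsilon>"
    using local_Lipschitz_cube[OF False A] by metis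
  obtain R where R: "\<And>x k. x \<in> \<Omega> \<Longrightarrow> k \<in> V \<Longrightarrow> \<bar>x k\<bar> \<le> R" by (rule \<Omega>_bounded) blast
  have "(\<integral>\<^sup>+x. f x \<partial>leb V) = emeasure \<mu> (space \<mu>)"
    unfolding \<mu>_def using f_measurable by (subst emeasure_density) (auto intro!: nn_integral_cong)
  then have fin: "(\<integral>\<^sup>+x. f x \<partial>leb V) < \<infinity>" using prob by (simp add: prob_space.emeasure_space_1)
  have marg: "marginal A \<mu> = density (leb A) (\<lambda>x. ennreal (?g x))"
    unfolding \<mu>_def by (rule marginal_eq_density[OF finV A False f_measurable f_nonneg fin])
  have "(\<lambda>x. restrict x A) \<in> \<mu> \<rightarrow>\<^sub>M leb A"
    unfolding \<mu>_def using measurable_restrict_subset[OF A] by (simp add: measurable_density_eq1)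
  then have pm: "prob_space (marginal A \<mu>)"
    unfolding marginal_def by (rule prob_space.prob_space_distr[OF prob])
  have chr: "christoffel A ?g ?z \<epsilon> R ?S" if \<epsilon>: "0 < \<epsilon>" "\<epsilon> \<le> \<delta>" for \<epsilon>
  proof (rule christoffel.intro)
    show "finite A" by fact
    show "?g \<in> borel_measurable (leb A)"
      by (rule marginal_density_measurable[OF finV A False f_measurable f_nonneg])
    show "\<And>x. x \<in> A \<rightarrow>\<^sub>E UNIV \<Longrightarrow> 0 \<le> ?g x"
      by (rule marginal_density_nonneg[OF finV A False f_measurable f_nonneg])
    show "prob_space (density (leb A) ?g)" using pm marg by simp
    show "\<bar>x k\<bar> \<le> R" if x: "x \<in> A \<rightarrow>\<^sub>E UNIV" "?g x \<noteq> 0" "k \<in> A" for x k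
    proof -
      have "x \<in> coord_proj A \<Omega>" using zero[OF False A, of x] x by blast
      then obtain w where "w \<in> \<Omega>" "x = restrict w A" unfolding coord_proj_def by blast
      then show ?thesis using R[of w k] x(3) A by auto
    qed
    show sub: "cube A ?z \<epsilon> \<subseteq> ?S" using cube_mono[OF \<epsilon>(2), of A ?z] \<delta>(2) by blast
    show "continuous_map (subtopology (powertop_real A) ?S) euclideanreal ?g" by (rule continuous[OF False A])
    show "0 < ?g x" if "x \<in> cube A ?z \<epsilon>" for x by (rule positive[OF False A subsetD[OF sub that]])
  qed fact
  define \<Lambda> where "\<Lambda> \<epsilon> = christoffel.N A ?g ?z \<epsilon>" for \<epsilon>
  have "((\<lambda>\<epsilon>. L * \<epsilon>) \<longlongrightarrow> L * 0) (at_right 0)" by (intro tendsto_intros)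
  then have "\<forall>\<^sub>F \<epsilon> in at_right 0. L * \<epsilon> < m A z"
    using m_pos[OF A] by (intro order_tendstoD(2)[of _ 0]) auto
  moreover have "\<forall>\<^sub>F \<epsilon> in at_right 0. \<epsilon> \<in> {0<..<\<delta>}" using \<delta>(1) by (rule eventually_at_right_real)
  ultimately have "\<forall>\<^sub>F \<epsilon> in at_right 0.
      (\<lambda>n. reg_christoffel A (marginal A \<mu>) n ?z \<epsilon>) \<longlonglongrightarrow> \<Lambda> \<epsilon> \<and> \<Lambda> \<epsilon> > 0 \<and>
      \<bar>inverse (\<epsilon> ^ card A * \<Lambda> \<epsilon>) - m A z\<bar> \<le> L * \<epsilon>"
  proof eventually_elim
    case (elim \<epsilon>)
    interpret christoffel A ?g ?z \<epsilon> R ?S using chr elim by auto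
    have "\<bar>inverse (\<epsilon> ^ card A * N) - m A z\<bar> \<le> L * \<epsilon>"
      using L[of \<epsilon>] elim by (intro avg_inverse_bounds) auto
    then show ?case
      using reg_christoffel_tendsto[OF False] N_pos by (simp add: marg \<Lambda>_def)
  qed
  then show ?thesis by blast
qed

text \<open>
  Cubes around \<open>z\<close> have positive measure, so the almost everywhere identity holds at points of
  arbitrarily small cubes; these points converge to \<open>z\<close>, where the marginal densities are continuous.
\<close>
lemma cond_indep_pointwise:
  assumes sub: "A \<subseteq> V" "B \<subseteq> V" "C \<subseteq> V" and ci: "cond_indep V f A B C"
  shows "m C z * m (A \<union> B \<union> C) z = m (A \<union> C) z * m (B \<union> C) z"
proof -
  define r where "r = (\<lambda>j. inverse (real (Suc j)))"
  have r: "r j > 0" "r \<longlonglongrightarrow> 0" for j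
    unfolding r_def by (simp, rule LIMSEQ_inverse_real_of_nat)
  have AE: "AE x in leb V. m C x * m (A \<union> B \<union> C) x = m (A \<union> C) x * m (B \<union> C) x"
    using ci by (simp add: cond_indep_def m_def Let_def)
  have "\<exists>x. x \<in> cube V z (r j) \<and> m C x * m (A \<union> B \<union> C) x = m (A \<union> C) x * m (B \<union> C) x" for j
  proof (rule ccontr)
    assume n: "\<not> ?thesis"
    from AE have "AE x in leb V. x \<notin> cube V z (r j)"
      by eventually_elim (use n in auto)
    moreover have "{x \<in> space (leb V). \<not> x \<notin> cube V z (r j)} = cube V z (r j)"
      by (auto simp: cube_def space_PiM)
    ultimately have "emeasure (leb V) (cube V z (r j)) = 0"
      using AE_iff_measurable[OF cube_measurable[OF finV], of "\<lambda>x. x \<notin> cube V z (r j)"] by (simp only:)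
    then show False using emeasure_cube[OF finV r(1)[of j], of z] r(1)[of j] by simp
  qed
  then obtain x where x: "\<And>j. x j \<in> cube V z (r j)"
      "\<And>j. m C (x j) * m (A \<union> B \<union> C) (x j) = m (A \<union> C) (x j) * m (B \<union> C) (x j)"
    by metis
  have lim: "(\<lambda>j. m D (x j)) \<longlonglongrightarrow> m D z" if D: "D \<subseteq> V" for D
  proof (cases "D = {}")
    case False
    obtain \<delta> L where \<delta>: "\<delta> > 0"
      and L: "\<And>\<epsilon> y. \<epsilon> \<le> \<delta> \<Longrightarrow> y \<in> cube D (restrict z D) \<epsilon> \<Longrightarrow> \<bar>marginal_density V f D y - m D z\<bar> \<le> L * \<epsilon>"
      using local_Lipschitz_cube[OF False D] by metis
    have "\<forall>\<^sub>F j in sequentially. r j < \<delta>" using r(2) \<delta> by (rule order_tendstoD)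
    then have "\<forall>\<^sub>F j in sequentially. norm (m D (x j) - m D z) \<le> L * r j"
      by eventually_elim (use L restrict_cube[OF x(1) D] in \<open>auto simp: m_def\<close>)
    moreover have "(\<lambda>j. L * r j) \<longlonglongrightarrow> 0" using tendsto_mult_left[OF r(2), of L] by simp
    ultimately have "(\<lambda>j. m D (x j) - m D z) \<longlonglongrightarrow> 0" by (rule Lim_null_comparison)
    then show ?thesis by (rule LIM_zero_cancel)
  qed (simp add: m_def marginal_density_def)
  have l: "(\<lambda>j. m C (x j) * m (A \<union> B \<union> C) (x j)) \<longlonglongrightarrow> m C z * m (A \<union> B \<union> C) z"
    using sub by (intro tendsto_mult lim) auto
  have "(\<lambda>j. m (A \<union> C) (x j) * m (B \<union> C) (x j)) \<longlonglongrightarrow> m (A \<union> C) z * m (B \<union> C) z"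
    using sub by (intro tendsto_mult lim) auto
  then show ?thesis using LIMSEQ_unique[OF l] unfolding x(2) by blast
qed

text \<open>
  If \<open>V\<close> is empty, \<open>m V z\<close> is 1 by convention, and \<open>f z = 1\<close> because the whole mass of \<open>\<mu>\<close> sits
  at the single point of \<open>\<real>\<^sup>0\<close>.
\<close>
lemma m_full: "m V z = f z"
proof (cases "V = {}")
  case True
  interpret product_sigma_finite "\<lambda>_. lborel" ..
  have "emeasure \<mu> (space \<mu>) = (\<integral>\<^sup>+x. f x \<partial>leb V)"
    unfolding \<mu>_def using f_measurable by (subst emeasure_density) (auto intro!: nn_integral_cong)
  also have "\<dots> = f (\<lambda>_. undefined)" unfolding True by (subst nn_integral_empty) auto
  finally have "ennreal (f (\<lambda>_. undefined)) = 1" using prob by (simp add: prob_space.emeasure_space_1)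
  moreover have "z = (\<lambda>_. undefined)" using z_space True by auto
  ultimately show ?thesis unfolding m_def marginal_density_def using True by simp
next
  case False
  then show ?thesis using marginal_density_full[OF z_space] z_space by (simp add: m_def)
qed

end

section \<open>Errors of first order\<close>

text \<open>
  Being equal to a constant up to \<open>O(h)\<close> is preserved by products and, when \<open>h\<close> tends to 0 and the
  constant is nonzero, by inverses.
\<close>
lemma bigo_diff_mult:
  fixes F G :: "'a \<Rightarrow> real"
  assumes F: "(\<lambda>x. F x - a) \<in> O[net](h)" and G: "(\<lambda>x. G x - b) \<in> O[net](h)" and h: "h \<in> O[net](\<lambda>_. 1)"
  shows "(\<lambda>x. F x * G x - a * b) \<in> O[net](h)"
proof -
  have "(\<lambda>x. (F x - a) * (G x - b)) \<in> O[net](\<lambda>x. h x * 1)"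
    by (rule landau_o.big.mult[OF F landau_o.big_trans[OF G h]])
  moreover have "(\<lambda>x. b * (F x - a)) \<in> O[net](h)" "(\<lambda>x. a * (G x - b)) \<in> O[net](h)"
    using F G by (auto intro: landau_o.big.mult_in_1)
  ultimately have "(\<lambda>x. (F x - a) * (G x - b) + b * (F x - a) + a * (G x - b)) \<in> O[net](h)"
    by (intro sum_in_bigo) auto
  then show ?thesis by (simp add: algebra_simps)
qed

lemma bigo_diff_inverse:
  fixes F :: "'a \<Rightarrow> real"
  assumes F: "(\<lambda>x. F x - a) \<in> O[net](h)" and h: "h \<in> o[net](\<lambda>_. 1)" and a: "a \<noteq> 0"
  shows "(\<lambda>x. inverse (F x) - inverse a) \<in> O[net](h)"
proof -
  have "(\<lambda>x. F x - a) \<in> o[net](\<lambda>_. 1)" by (rule landau_o.big_small_trans[OF F h])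
  then have "((\<lambda>x. F x - a) \<longlongrightarrow> 0) net" by (auto dest: smalloD_tendsto)
  then have lim: "(F \<longlongrightarrow> a) net" by (rule LIM_zero_cancel)
  then have "((\<lambda>x. - inverse (F x) * inverse a) \<longlongrightarrow> - inverse a * inverse a) net"
    using a by (intro tendsto_intros)
  then have "((\<lambda>x. (- inverse (F x) * inverse a) / 1) \<longlongrightarrow> - inverse a * inverse a) net" by simp
  then have one: "(\<lambda>x. - inverse (F x) * inverse a) \<in> O[net](\<lambda>_. 1)"
    by (rule bigoI_tendsto) simp
  have "(\<lambda>x. (- inverse (F x) * inverse a) * (F x - a)) \<in> O[net](\<lambda>x. 1 * h x)"
    by (rule landau_o.big.mult[OF one F])
  moreover have "\<forall>\<^sub>F x in net. F x \<noteq> 0" using lim a by (rule tendsto_imp_eventually_ne)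
  then have "\<forall>\<^sub>F x in net. (- inverse (F x) * inverse a) * (F x - a) = inverse (F x) - inverse a"
    by eventually_elim (use a in \<open>simp add: field_simps\<close>)
  ultimately show ?thesis using landau_o.big.in_cong by fastforce
qed

lemma bigo_diff_prod:
  fixes F :: "'i \<Rightarrow> 'a \<Rightarrow> real"
  assumes "finite I" and "\<And>i. i \<in> I \<Longrightarrow> (\<lambda>x. F i x - a i) \<in> O[net](h)" and h: "h \<in> O[net](\<lambda>_. 1)"
  shows "(\<lambda>x. (\<Prod>i\<in>I. F i x) - (\<Prod>i\<in>I. a i)) \<in> O[net](h)"
  using assms(1,2)
proof (induction I rule: finite_induct)
  case (insert i I)
  have "(\<lambda>x. F i x * (\<Prod>i\<in>I. F i x) - a i * (\<Prod>i\<in>I. a i)) \<in> O[net](h)"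
    by (rule bigo_diff_mult[OF _ _ h]) (use insert in auto)
  then show ?case using insert.hyps by simp
qed simp

section \<open>The regularized rational Christoffel function\<close>

theorem corollary4p11:
  fixes d :: nat
    and \<mu> :: "(nat \<Rightarrow> real) measure"
    and f :: "(nat \<Rightarrow> real) \<Rightarrow> real"
    and \<Omega> :: "(nat \<Rightarrow> real) set"
    and G :: "nat graph" and J :: "nat set graph"
    and z :: "nat \<Rightarrow> real"
  assumes "prob_space \<mu>"
    and "f \<in> borel_measurable (leb {1..d})"
    and "\<And>x. x \<in> {1..d} \<rightarrow>\<^sub>E UNIV \<Longrightarrow> f x \<ge> 0"
    and "\<mu> = density (leb {1..d}) (\<lambda>x. ennreal (f x))"
    and "\<Omega> = msupport (powertop_real {1..d}) \<mu>"
    and "compactin (powertop_real {1..d}) \<Omega>"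
    and "\<And>A. A \<noteq> {} \<Longrightarrow> A \<subseteq> {1..d} \<Longrightarrow>
           coord_proj A \<Omega> = powertop_real A closure_of (powertop_real A interior_of coord_proj A \<Omega>)"
    and "\<And>A. A \<noteq> {} \<Longrightarrow> A \<subseteq> {1..d} \<Longrightarrow>
           continuous_map (subtopology (powertop_real A) (powertop_real A interior_of coord_proj A \<Omega>))
             euclideanreal (marginal_density {1..d} f A)"
    and "\<And>A x. A \<noteq> {} \<Longrightarrow> A \<subseteq> {1..d} \<Longrightarrow> x \<in> powertop_real A interior_of coord_proj A \<Omega> \<Longrightarrow>
           marginal_density {1..d} f A x > 0"
    and "\<And>A x. A \<noteq> {} \<Longrightarrow> A \<subseteq> {1..d} \<Longrightarrow> x \<in> (A \<rightarrow>\<^sub>E UNIV) - coord_proj A \<Omega> \<Longrightarrow>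
           marginal_density {1..d} f A x = 0"
    and "\<And>A. A \<noteq> {} \<Longrightarrow> A \<subseteq> {1..d} \<Longrightarrow>
           locally_Lipschitz_on A (powertop_real A interior_of coord_proj A \<Omega>)
             (marginal_density {1..d} f A)"
    and "graphical_model {1..d} f G"
    and "junction_tree G J"
    and "z \<in> powertop_real {1..d} interior_of \<Omega>"
  shows "\<exists>L :: real \<Rightarrow> real.
           (\<forall>\<^sub>F \<epsilon> in at_right 0.
              (\<lambda>n. inverse (\<epsilon> ^ d) * inverse (reg_rational_christoffel \<mu> J n z \<epsilon>)) \<longlonglongrightarrow> L \<epsilon>) \<and>
           (\<lambda>\<epsilon>. L \<epsilon> - f z) \<in> O[at_right 0](\<lambda>\<epsilon>. \<epsilon>)"
proof -
  let ?V = "{1..d}"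
  interpret marginal_regularity ?V \<mu> f \<Omega> z
    by (rule marginal_regularity.intro) (use assms in \<open>simp_all\<close>)
  have G: "simple_graph G" "verts G = ?V" and ci: "\<And>A B C. A \<subseteq> ?V \<Longrightarrow> B \<subseteq> ?V \<Longrightarrow> C \<subseteq> ?V \<Longrightarrow>
      separated G A B C \<Longrightarrow> cond_indep ?V f A B C"
    using \<open>graphical_model {1..d} f G\<close> by (auto simp: graphical_model_def)
  have finG: "finite (verts G)" using G by simp
  note J = \<open>junction_tree G J\<close>
  have JV: "C \<subseteq> ?V" if "C \<in> verts J" for C using junction_tree_cliques(1)[OF J finG G(1)] that G(2) by auto
  have finJ: "finite (verts J)" by (rule finite_subset[of _ "Pow ?V"]) (use JV in auto)
  have "simple_graph J" using J by (simp add: junction_tree_def is_tree_def)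
  then have edge: "\<exists>A B. e = {A, B} \<and> A \<in> verts J \<and> B \<in> verts J" if "e \<in> edges J" for e
    using that by (auto simp: simple_graph_def)
  have finE: "finite (edges J)" by (rule finite_subset[of _ "Pow (verts J)"]) (use edge finJ in auto)
  have EV: "\<Inter>e \<subseteq> ?V" if e: "e \<in> edges J" for e
  proof -
    obtain A B where "e = {A, B}" "A \<in> verts J" using edge[OF e] by blast
    then show ?thesis using JV[of A] by auto
  qed
  have "m (verts G) z * (\<Prod>e\<in>edges J. m (\<Inter>e) z) = (\<Prod>C\<in>verts J. m C z)"
  proof (rule junction_tree_factorization[OF J finG G(1)])
    fix A B C assume "A \<subseteq> verts G" "B \<subseteq> verts G" "C \<subseteq> verts G" "separated G A B C"
    then show "m C z * m (A \<union> B \<union> C) z = m (A \<union> C) z * m (B \<union> C) z"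
      unfolding G(2) by (intro cond_indep_pointwise ci)
  qed
  then have factor: "f z * (\<Prod>e\<in>edges J. m (\<Inter>e) z) = (\<Prod>C\<in>verts J. m C z)"
    by (simp only: G(2) m_full)
  have "\<forall>A\<in>Pow ?V. \<exists>\<Lambda> C. \<forall>\<^sub>F \<epsilon> in at_right 0.
      (\<lambda>n. reg_christoffel A (marginal A \<mu>) n (restrict z A) \<epsilon>) \<longlonglongrightarrow> \<Lambda> \<epsilon> \<and> \<Lambda> \<epsilon> > 0 \<and>
      \<bar>inverse (\<epsilon> ^ card A * \<Lambda> \<epsilon>) - m A z\<bar> \<le> C * \<epsilon>"
    by (intro ballI christoffel_asymptotics) simp
  from bchoice[OF this] obtain \<Lambda> where "\<forall>A\<in>Pow ?V. \<exists>C. \<forall>\<^sub>F \<epsilon> in at_right 0.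
      (\<lambda>n. reg_christoffel A (marginal A \<mu>) n (restrict z A) \<epsilon>) \<longlonglongrightarrow> \<Lambda> A \<epsilon> \<and> \<Lambda> A \<epsilon> > 0 \<and>
      \<bar>inverse (\<epsilon> ^ card A * \<Lambda> A \<epsilon>) - m A z\<bar> \<le> C * \<epsilon>" by (elim exE)
  from bchoice[OF this] obtain K where \<Lambda>: "\<forall>A\<in>Pow ?V. \<forall>\<^sub>F \<epsilon> in at_right 0.
      (\<lambda>n. reg_christoffel A (marginal A \<mu>) n (restrict z A) \<epsilon>) \<longlonglongrightarrow> \<Lambda> A \<epsilon> \<and> \<Lambda> A \<epsilon> > 0 \<and>
      \<bar>inverse (\<epsilon> ^ card A * \<Lambda> A \<epsilon>) - m A z\<bar> \<le> K A * \<epsilon>" by (elim exE)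
  define a where "a A \<epsilon> = inverse (\<epsilon> ^ card A * \<Lambda> A \<epsilon>)" for A \<epsilon>
  \<comment> \<open>Every \<open>a A \<epsilon>\<close> is close to the marginal density at \<open>z\<^sub>A\<close>. The powers of \<open>\<epsilon>\<close> hidden in
    \<open>L \<epsilon>\<close> combine to \<open>inverse (\<epsilon> ^ d)\<close>, which makes it the limit over \<open>n\<close>.\<close>
  define L where "L \<epsilon> = (\<Prod>C\<in>verts J. a C \<epsilon>) * inverse (\<Prod>e\<in>edges J. a (\<Inter>e) \<epsilon>)" for \<epsilon>
  have pos: "\<forall>\<^sub>F \<epsilon> in at_right (0::real). \<epsilon> > 0" by (rule eventually_at_right_less)
  have small: "(\<lambda>\<epsilon>::real. \<epsilon>) \<in> o[at_right 0](\<lambda>_. 1)"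
    by (rule smalloI_tendsto) (auto intro!: tendsto_eq_intros)
  then have big: "(\<lambda>\<epsilon>::real. \<epsilon>) \<in> O[at_right 0](\<lambda>_. 1)" by (rule landau_o.small_imp_big)
  have a: "(\<lambda>\<epsilon>. a A \<epsilon> - m A z) \<in> O[at_right 0](\<lambda>\<epsilon>. \<epsilon>)" if "A \<subseteq> ?V" for A
  proof (rule bigoI[of _ "K A"])
    have "\<forall>\<^sub>F \<epsilon> in at_right 0. \<bar>inverse (\<epsilon> ^ card A * \<Lambda> A \<epsilon>) - m A z\<bar> \<le> K A * \<epsilon>"
      using bspec[OF \<Lambda>, of A] that by (auto elim: eventually_mono)
    then show "\<forall>\<^sub>F \<epsilon> in at_right 0. norm (a A \<epsilon> - m A z) \<le> K A * norm \<epsilon>"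
      using pos by eventually_elim (simp add: a_def)
  qed
  have ne: "(\<Prod>e\<in>edges J. m (\<Inter>e) z) \<noteq> 0" using m_pos[OF EV] finE by (simp add: less_imp_neq[symmetric])
  have "(\<lambda>\<epsilon>. L \<epsilon> - (\<Prod>C\<in>verts J. m C z) * inverse (\<Prod>e\<in>edges J. m (\<Inter>e) z)) \<in> O[at_right 0](\<lambda>\<epsilon>. \<epsilon>)"
    unfolding L_def using JV EV finJ finE ne
    by (intro bigo_diff_mult bigo_diff_inverse bigo_diff_prod big small a) auto
  moreover have "(\<Prod>C\<in>verts J. m C z) * inverse (\<Prod>e\<in>edges J. m (\<Inter>e) z) = f z"
    using ne unfolding factor[symmetric] by simp
  ultimately have bigo: "(\<lambda>\<epsilon>. L \<epsilon> - f z) \<in> O[at_right 0](\<lambda>\<epsilon>. \<epsilon>)" by simp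
  have "\<forall>\<^sub>F \<epsilon> in at_right 0. \<forall>A\<in>Pow ?V.
      (\<lambda>n. reg_christoffel A (marginal A \<mu>) n (restrict z A) \<epsilon>) \<longlonglongrightarrow> \<Lambda> A \<epsilon> \<and> \<Lambda> A \<epsilon> > 0"
    using \<Lambda> by (intro eventually_ball_finite) (auto elim: eventually_mono)
  then have "\<forall>\<^sub>F \<epsilon> in at_right 0.
      (\<lambda>n. inverse (\<epsilon> ^ d) * inverse (reg_rational_christoffel \<mu> J n z \<epsilon>)) \<longlonglongrightarrow> L \<epsilon>"
    using pos
  proof eventually_elim
    case (elim \<epsilon>)
    have lim: "(\<lambda>n. reg_christoffel A (marginal A \<mu>) n (restrict z A) \<epsilon>) \<longlonglongrightarrow> \<Lambda> A \<epsilon>"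
      and \<Lambda>_pos: "\<Lambda> A \<epsilon> > 0" if "A \<subseteq> ?V" for A
      using elim(1) that by auto
    define PC where "PC = (\<Prod>C\<in>verts J. \<Lambda> C \<epsilon>)"
    define PE where "PE = (\<Prod>e\<in>edges J. \<Lambda> (\<Inter>e) \<epsilon>)"
    have P: "PC > 0" "PE > 0" unfolding PC_def PE_def using \<Lambda>_pos JV EV by (auto intro!: prod_pos)
    have "(\<lambda>n. reg_rational_christoffel \<mu> J n z \<epsilon>) \<longlonglongrightarrow> PC / PE"
      unfolding reg_rational_christoffel_def Let_def PC_def PE_def
      using P(2) JV EV unfolding PE_def by (intro tendsto_divide tendsto_prod lim) auto
    then have "(\<lambda>n. inverse (\<epsilon> ^ d) * inverse (reg_rational_christoffel \<mu> J n z \<epsilon>))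
        \<longlonglongrightarrow> inverse (\<epsilon> ^ d) * inverse (PC / PE)"
      using P by (intro tendsto_intros) auto
    moreover have "inverse (\<epsilon> ^ d) * inverse (PC / PE) = L \<epsilon>"
    proof -
      define XC where "XC = (\<Prod>C\<in>verts J. \<epsilon> ^ card C)"
      define XE where "XE = (\<Prod>e\<in>edges J. \<epsilon> ^ card (\<Inter>e))"
      have X: "XC > 0" "XE > 0" unfolding XC_def XE_def using elim(2) by (auto intro!: prod_pos)
      have XC: "XC = \<epsilon> ^ d * XE"
        using junction_tree_power_card[OF J finG G(1), of \<epsilon>] by (simp add: G(2) XC_def XE_def)
      have "(\<Prod>C\<in>verts J. a C \<epsilon>) = inverse (XC * PC)"
        by (simp add: a_def XC_def PC_def prod.distrib prod_inversef[symmetric])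
      moreover have "(\<Prod>e\<in>edges J. a (\<Inter>e) \<epsilon>) = inverse (XE * PE)"
        by (simp add: a_def XE_def PE_def prod.distrib prod_inversef[symmetric])
      ultimately have "L \<epsilon> = inverse (\<epsilon> ^ d * XE * PC) * (XE * PE)" unfolding L_def XC by simp
      then show ?thesis using X P elim(2) by (simp add: field_simps)
    qed
    ultimately show ?case by simp
  qed
  with bigo show ?thesis by blast
qed

end
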